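(* Assume that there is $\epsilon>0$ such that for all $i,l$, $\tilde f_{i;\mathrm{res}}(x)=O(\kappa(x)^{-(1+\epsilon)})$ and $\frac{\partial\tilde f_{i;\mathrm{res}}}{\partial x_l}(x)=o(\kappa(x)^{-(1+\epsilon)})$ as $x\in\mathcal{D}$ approaches $\mathcal{E}$, and that $G(x_\ast)>0$ for any equilibrium $x_\ast\in\mathcal{E}$ of $g$ under consideration. Let $Y_0\in\mathbb{R}^n$ be a nonzero root of the balance law $-\frac1k\Lambda_\alpha Y_0+f_{\alpha,k}(Y_0)=0$, and assume that the blow-up power-determining matrix $A=-\frac1k\Lambda_\alpha+Df_{\alpha,k}(Y_0)$ is hyperbolic: $\mathrm{Spec}(A)\cap i\mathbb{R}=\emptyset$. Then the ODE $y'=f(y)$ possesses a solution $y(t)$ which blows up at some $t_{\max}<\infty$, with the asymptotic behavior $$y_i(t)\sim Y_{0,i}\,(t_{\max}-t)^{-\alpha_i/k}\quad\text{as } t\to t_{\max}-0,$$ for each $i$ such that $Y_{0,i}\neq0$.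
   Context: Let $n\ge1$, $\alpha=(\alpha_1,\ldots,\alpha_n)$ positive integers, $k>0$ real, $\Lambda_\alpha=\mathrm{diag}(\alpha_1,\ldots,\alpha_n)$, and $s^{\Lambda_\alpha}=\mathrm{diag}(s^{\alpha_1},\ldots,s^{\alpha_n})$ for $s>0$. The map $f:\mathbb{R}^n\to\mathbb{R}^n$ is $C^r$ with $r\ge2$ and is asymptotically quasi-homogeneous of type $\alpha$ and order $k+1$ at infinity: there is a quasi-homogeneous vector field $f_{\alpha,k}$, i.e. $f_{i;\alpha,k}(s^{\Lambda_\alpha}x)=s^{k+\alpha_i}f_{i;\alpha,k}(x)$ for all $x\in\mathbb{R}^n$, $s>0$, such that $f_i(s^{\Lambda_\alpha}x)-s^{k+\alpha_i}f_{i;\alpha,k}(x)=o(s^{k+\alpha_i})$ as $s\to+\infty$, uniformly for $x$ in the unit sphere. $f_{\alpha,k}$ is $C^1$. Put $f_{\mathrm{res}}=f-f_{\alpha,k}$. Quasi-parabolic compactification: $c$ is the least common multiple of $\alpha_1,\ldots,\alpha_n$, $\beta_i=c/\alpha_i$, $p(x)=\big(\sum_i x_i^{2\beta_i}\big)^{1/(2c)}$, $\mathcal{D}=\{p<1\}$, horizon $\mathcal{E}=\{p=1\}$, $\overline{\mathcal{D}}=\{p\le1\}$, $\kappa(x)=(1-p(x)^{2c})^{-1}$ on $\mathcal D$; variables are related by $y=\kappa(x)^{\Lambda_\alpha}x$. On $\mathcal{D}$ put $\tilde f_i(x)=\kappa^{-(k+\alpha_i)}f_i(\kappa^{\Lambda_\alpha}x)$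 and $\tilde f_{i;\mathrm{res}}(x)=\kappa^{-(k+\alpha_i)}f_{i;\mathrm{res}}(\kappa^{\Lambda_\alpha}x)$; $\tilde f$ is extended continuously to $\mathcal{E}$ by $\tilde f=f_{\alpha,k}$. Put $G(x)=\sum_j\frac{x_j^{2\beta_j-1}}{\alpha_j}\tilde f_j(x)$. The desingularized vector field on $\overline{\mathcal{D}}$ is $$g(x)=\Big(1-\tfrac{2c-1}{2c}(1-p(x)^{2c})\Big)\tilde f(x)-G(x)\Lambda_\alpha x ,$$ and an equilibrium on the horizon is $x_\ast\in\mathcal{E}$ with $g(x_\ast)=0$. (The equilibrium corresponding to $Y_0$ is $x_\ast=p(Y_0)^{-\Lambda_\alpha}Y_0$.) A solution $y(t)$ blows up at $t_{\max}<\infty$ if $|y(t)|\to\infty$ as $t\to t_{\max}-0$. For scalar functions, $h_1\sim h_2$ means $h_1/h_2\to1$. *)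

theory Defs
  imports "HOL-Analysis.Analysis" "HOL-Library.Landau_Symbols"
begin

fun C_r_map :: "nat \<Rightarrow> ('a::euclidean_space \<Rightarrow> 'b::real_normed_vector) \<Rightarrow> bool" where
  "C_r_map 0 f \<longleftrightarrow> continuous_on UNIV f"
| "C_r_map (Suc r) f \<longleftrightarrow>
     (\<forall>x. f differentiable (at x)) \<and>
     (\<forall>b\<in>Basis. C_r_map r (\<lambda>x. frechet_derivative f (at x) b))"

definition diag_type :: "('n::finite \<Rightarrow> nat) \<Rightarrow> real^'n^'n" where
  "diag_type \<alpha> = (\<chi> i j. if i = j then real (\<alpha> i) else 0)"

text \<open>The action \<open>s\<^sup>\<Lambda> x\<close> of the diagonal matrix with entries \<open>s ^ \<alpha> i\<close>;
  used for \<open>s > 0\<close> only.\<close>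
definition qscale :: "('n::finite \<Rightarrow> nat) \<Rightarrow> real \<Rightarrow> real^'n \<Rightarrow> real^'n" where
  "qscale \<alpha> s x = (\<chi> i. s ^ \<alpha> i * x $ i)"

text \<open>Quasi-homogeneous of type \<open>\<alpha>\<close> and order \<open>k + 1\<close>.\<close>
definition quasi_homogeneous ::
  "('n::finite \<Rightarrow> nat) \<Rightarrow> real \<Rightarrow> (real^'n \<Rightarrow> real^'n) \<Rightarrow> bool" where
  "quasi_homogeneous \<alpha> k F \<longleftrightarrow>
     (\<forall>x s i. s > 0 \<longrightarrow> F (qscale \<alpha> s x) $ i = s powr (k + real (\<alpha> i)) * F x $ i)"

text \<open>\<open>f\<close> is asymptotically quasi-homogeneous at infinity with quasi-homogeneous part \<open>F\<close>.\<close>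
definition asymp_quasi_homogeneous ::
  "('n::finite \<Rightarrow> nat) \<Rightarrow> real \<Rightarrow> (real^'n \<Rightarrow> real^'n) \<Rightarrow> (real^'n \<Rightarrow> real^'n) \<Rightarrow> bool" where
  "asymp_quasi_homogeneous \<alpha> k f F \<longleftrightarrow>
     quasi_homogeneous \<alpha> k F \<and>
     (\<forall>i. uniform_limit (sphere 0 1)
        (\<lambda>s x. (f (qscale \<alpha> s x) $ i - s powr (k + real (\<alpha> i)) * F x $ i)
                 / s powr (k + real (\<alpha> i)))
        (\<lambda>x. 0) at_top)"

definition lcm_type :: "('n::finite \<Rightarrow> nat) \<Rightarrow> nat" where
  "lcm_type \<alpha> = Lcm (range \<alpha>)"

definition beta :: "('n::finite \<Rightarrow> nat) \<Rightarrow> 'n \<Rightarrow> nat" where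
  "beta \<alpha> i = lcm_type \<alpha> div \<alpha> i"

definition pfun :: "('n::finite \<Rightarrow> nat) \<Rightarrow> real^'n \<Rightarrow> real" where
  "pfun \<alpha> x = root (2 * lcm_type \<alpha>) (\<Sum>i\<in>UNIV. (x $ i) ^ (2 * beta \<alpha> i))"

definition kappa :: "('n::finite \<Rightarrow> nat) \<Rightarrow> real^'n \<Rightarrow> real" where
  "kappa \<alpha> x = 1 / (1 - pfun \<alpha> x ^ (2 * lcm_type \<alpha>))"

definition horizon :: "('n::finite \<Rightarrow> nat) \<Rightarrow> (real^'n) set" where
  "horizon \<alpha> = {x. pfun \<alpha> x = 1}"

text \<open>The filter \<open>x \<in> \<D>\<close>, \<open>x \<rightarrow> \<E>\<close>: its basic sets are \<open>{x. 1 - \<delta> < p x < 1}\<close>.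
  As the horizon is compact, these are the traces on \<open>\<D>\<close> of its neighbourhoods.\<close>
definition to_horizon :: "('n::finite \<Rightarrow> nat) \<Rightarrow> (real^'n) filter" where
  "to_horizon \<alpha> = filtercomap (pfun \<alpha>) (at_left 1)"

text \<open>The rescaling \<open>h \<mapsto> h~\<close> on \<open>\<D>\<close>; meaningless where \<open>p x \<ge> 1\<close>.\<close>
definition tilde_in ::
  "('n::finite \<Rightarrow> nat) \<Rightarrow> real \<Rightarrow> (real^'n \<Rightarrow> real^'n) \<Rightarrow> real^'n \<Rightarrow> real^'n" where
  "tilde_in \<alpha> k h x =
     (\<chi> i. kappa \<alpha> x powr (- (k + real (\<alpha> i))) * h (qscale \<alpha> (kappa \<alpha> x) x) $ i)"

text \<open>\<open>f~\<close> on the closed domain: the continuous extension to the horizon is the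
  quasi-homogeneous part \<open>F\<close>.\<close>
definition tilde ::
  "('n::finite \<Rightarrow> nat) \<Rightarrow> real \<Rightarrow> (real^'n \<Rightarrow> real^'n) \<Rightarrow> (real^'n \<Rightarrow> real^'n)
     \<Rightarrow> real^'n \<Rightarrow> real^'n" where
  "tilde \<alpha> k f F x = (if pfun \<alpha> x < 1 then tilde_in \<alpha> k f x else F x)"

definition Gfun ::
  "('n::finite \<Rightarrow> nat) \<Rightarrow> real \<Rightarrow> (real^'n \<Rightarrow> real^'n) \<Rightarrow> (real^'n \<Rightarrow> real^'n)
     \<Rightarrow> real^'n \<Rightarrow> real" where
  "Gfun \<alpha> k f F x =
     (\<Sum>j\<in>UNIV. (x $ j) ^ (2 * beta \<alpha> j - 1) / real (\<alpha> j) * tilde \<alpha> k f F x $ j)"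

definition desing_field ::
  "('n::finite \<Rightarrow> nat) \<Rightarrow> real \<Rightarrow> (real^'n \<Rightarrow> real^'n) \<Rightarrow> (real^'n \<Rightarrow> real^'n)
     \<Rightarrow> real^'n \<Rightarrow> real^'n" where
  "desing_field \<alpha> k f F x =
     (let c = lcm_type \<alpha> in
       (1 - (2 * real c - 1) / (2 * real c) * (1 - pfun \<alpha> x ^ (2 * c))) *\<^sub>R tilde \<alpha> k f F x
       - Gfun \<alpha> k f F x *\<^sub>R (diag_type \<alpha> *v x))"

definition horizon_equilibrium ::
  "('n::finite \<Rightarrow> nat) \<Rightarrow> real \<Rightarrow> (real^'n \<Rightarrow> real^'n) \<Rightarrow> (real^'n \<Rightarrow> real^'n)
     \<Rightarrow> real^'n \<Rightarrow> bool" where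
  "horizon_equilibrium \<alpha> k f F x \<longleftrightarrow> x \<in> horizon \<alpha> \<and> desing_field \<alpha> k f F x = 0"

definition blowup_matrix ::
  "('n::finite \<Rightarrow> nat) \<Rightarrow> real \<Rightarrow> (real^'n \<Rightarrow> real^'n) \<Rightarrow> real^'n \<Rightarrow> real^'n^'n" where
  "blowup_matrix \<alpha> k F Y = - ((1 / k) *\<^sub>R diag_type \<alpha>) + jacobian F (at Y)"

definition Spec :: "real^'n^'n \<Rightarrow> complex set" where
  "Spec A = {z. \<exists>v::complex^'n. v \<noteq> 0 \<and> map_matrix complex_of_real A *v v = z *s v}"

definition hyperbolic_matrix :: "real^'n^'n \<Rightarrow> bool" where
  "hyperbolic_matrix A \<longleftrightarrow> Spec A \<inter> {z. Re z = 0} = {}"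

definition solves_on ::
  "(real^'n \<Rightarrow> real^'n) \<Rightarrow> (real \<Rightarrow> real^'n::finite) \<Rightarrow> real set \<Rightarrow> bool" where
  "solves_on f y I \<longleftrightarrow> (\<forall>t\<in>I. (y has_vector_derivative f (y t)) (at t within I))"

end

theory Submission
  imports Defs "HOL-Computational_Algebra.Fundamental_Theorem_Algebra"
begin

text \<open>Normalize the blow-up time to 0 and put \<open>s = - ln (- t)\<close>, \<open>\<sigma> = exp (s / k)\<close> and \<open>y = \<sigma>\<^sup>\<Lambda> Y\<close>. Then \<open>y' = f y\<close> becomes
  \<open>dY/ds = F Y - (1/k) \<Lambda> Y + h\<close>, where \<open>h\<^sub>i(s, Y) = \<sigma>\<^bsup>-(k + \<alpha>\<^sub>i)\<^esup> f\<^sub>r\<^sub>e\<^sub>s\<^sub>,\<^sub>i(\<sigma>\<^sup>\<Lambda> Y)\<close>, and the claim is that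
  this equation has a solution with \<open>Y \<rightarrow> Y\<^sub>0\<close>. For \<open>Z = Y - Y\<^sub>0\<close> the equation reads \<open>Z' = A Z + N(s, Z)\<close>
  with \<open>A\<close> hyperbolic. The linear problem \<open>Z' = A Z + g\<close> has a bounded solution operator on bounded
  functions on the real line which preserves decay at \<open>+\<infinity>\<close>, so that \<open>Z\<close> is obtained as a Banach
  fixed point once \<open>N\<close> is small with a small Lipschitz constant in \<open>Z\<close>. For the residual term \<open>h\<close> the
  latter follows from the hypotheses on \<open>f\<^sub>r\<^sub>e\<^sub>s\<close> in the compactified variable \<open>x\<close>: the change from
  \<open>Y\<close> to \<open>x\<close> is Lipschitz uniformly in \<open>\<sigma>\<close>, and the derivative bound can be integrated along segments
  because \<open>\<D>\<close> is convex.\<close>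

section \<open>Bounded solutions of linear equations\<close>

text \<open>No initial value is prescribed, and the right one is not known in advance. Asking for a
  bounded solution on the whole line takes its place: one linear operator then does the work of the
  stable and unstable subspaces of A. To have an equation on the whole line, \<sigma> is frozen
  before some time S. The operator is assembled from scalar equations by splitting an annihilating
  polynomial of A over the complex numbers, so neither a Jordan form nor a matrix exponential
  enters.

  The obstacle in the residual term is that the hypotheses scale by \<kappa>(x), which varies with
  the point, whereas h scales by \<sigma>, the same for all Y. The two are linked by \<sigma> = b
  \<kappa>(x), where b solves b^(2c) q(Y) + b/\<sigma> = 1 and q = p^(2c). Near Y0 and for large
  \<sigma>, b stays between positive constants and is Lipschitz in Y uniformly in \<sigma>.

  Two kinds of smallness have different origins: the Lipschitz constant of N is small because the
  derivatives tend to 0 at the horizon and Y stays near Y0, while N(s, 0) is small compared with the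
  radius because \<sigma> is taken large after the radius is fixed.\<close>

lemma integrable_exp_minus_atLeast:
  fixes a :: real
  assumes "a > 0"
  shows "integrable lborel (\<lambda>u. indicator {0..} u * exp (- a * u))"
proof -
  have "(\<lambda>u. exp (- a * u)) absolutely_integrable_on {0..}"
    by (intro nonnegative_absolutely_integrable_1 integrable_on_exp_minus_to_infinity assms) auto
  then have "integrable lebesgue (\<lambda>u. indicator {0..} u * exp (- a * u))"
    by (simp add: set_integrable_def)
  then show ?thesis
    by (subst (asm) integrable_completion) auto
qed

text \<open>Near \<open>t\<close> the tail is a constant minus an integral over a compact interval,
  to which the fundamental theorem of calculus applies. The window from \<open>t - 1\<close> to
  \<open>t + 1\<close> keeps \<open>t\<close> interior, so the one-interval derivative is a full
  one.\<close>

lemma has_vector_derivative_tail_integral: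
  fixes H :: "real \<Rightarrow> 'a::euclidean_space"
  assumes cont: "continuous_on UNIV H"
    and int: "\<And>t. set_integrable lborel {t..} H"
  shows "((\<lambda>t. LINT s:{t..}|lborel. H s) has_vector_derivative - H t) (at t)"
proof -
  define a b where "a = t - 1" and "b = t + 1"
  have eq: "(LINT s:{u..}|lborel. H s) = (LINT s:{a..}|lborel. H s) - integral {a..u} H"
    if u: "u \<in> {a..b}" for u
  proof -
    have i1: "set_integrable lborel {a..u} H"
      by (rule set_integrable_subset[OF int[of a]]) auto
    have i2: "set_integrable lborel {u<..} H"
      by (rule set_integrable_subset[OF int[of u]]) auto
    have "{a..} = {a..u} \<union> {u<..}" and "{a..u} \<inter> {u<..} = {}" using u by auto
    then have "(LINT s:{a..}|lborel. H s) = (LINT s:{a..u}|lborel. H s) + (LINT s:{u<..}|lborel. H s)"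
      using set_integral_Un[OF _ i1 i2] by simp
    moreover have "(LINT s:{u<..}|lborel. H s) = (LINT s:{u..}|lborel. H s)"
    proof (rule set_integral_cong_set)
      show "set_borel_measurable lborel {u<..} H" "set_borel_measurable lborel {u..} H"
        using i2 int[of u] unfolding set_integrable_def set_borel_measurable_def by auto
      show "AE x in lborel. (x \<in> {u..}) = (x \<in> {u<..})"
        using AE_lborel_singleton[of u] by eventually_elim auto
    qed
    moreover have "(LINT s:{a..u}|lborel. H s) = integral {a..u} H"
      by (rule set_borel_integral_eq_integral(2)[OF i1])
    ultimately show ?thesis by simp
  qed
  have "((\<lambda>u. integral {a..u} H) has_vector_derivative H t) (at t within {a..b})"
    by (rule integral_has_vector_derivative)
      (auto intro: continuous_on_subset[OF cont] simp: a_def b_def)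
  then have "((\<lambda>u. (LINT s:{a..}|lborel. H s) - integral {a..u} H) has_vector_derivative 0 - H t)
      (at t within {a..b})"
    by (intro derivative_intros)
  from has_vector_derivative_transform[OF _ eq this]
  have "((\<lambda>u. LINT s:{u..}|lborel. H s) has_vector_derivative - H t) (at t within {a..b})"
    by (simp add: a_def b_def)
  then show ?thesis
    by (subst (asm) at_within_interior) (auto simp: a_def b_def)
qed

section \<open>Operators on bounded continuous functions that preserve decay at infinity\<close>

lemma bounded_linear_bcontfunI:
  fixes T :: "(real \<Rightarrow>\<^sub>C 'a::real_normed_vector) \<Rightarrow> real \<Rightarrow> 'b::real_normed_vector"
  assumes cont: "\<And>g. continuous_on UNIV (T g)"
    and add: "\<And>g h t. T (g + h) t = T g t + T h t"
    and scale: "\<And>c g t. T (c *\<^sub>R g) t = c *\<^sub>R T g t"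
    and bound: "\<And>g t. norm (T g t) \<le> norm g * K"
  shows "bounded_linear (\<lambda>g. Bcontfun (T g))" and "\<And>g. apply_bcontfun (Bcontfun (T g)) = T g"
proof -
  \<comment> \<open>\<open>Bcontfun\<close> can be inverted only on bounded continuous functions.
    The bound thus serves twice: it puts \<open>T g\<close> into the type, and later it gives the
    operator norm.\<close>
  show ap: "apply_bcontfun (Bcontfun (T g)) = T g" for g
    by (rule Bcontfun_inverse, rule bcontfun_normI[OF cont bound])
  show "bounded_linear (\<lambda>g. Bcontfun (T g))"
  proof (rule bounded_linear_intro[where K=K])
    show "Bcontfun (T (g + h)) = Bcontfun (T g) + Bcontfun (T h)" for g h
      by (rule bcontfun_eqI) (simp add: ap add)
    show "Bcontfun (T (c *\<^sub>R g)) = c *\<^sub>R Bcontfun (T g)" for c g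
      by (rule bcontfun_eqI) (simp add: ap scale)
    show "norm (Bcontfun (T g)) \<le> norm g * K" for g
      by (rule norm_bound) (simp add: ap bound)
  qed
qed

text \<open>Decay at \<open>at_top\<close> is what finally becomes the convergence of Y to Y0. The
  property is closed under sums and composition, so it survives the assembly of the solver from
  scalar pieces.\<close>

definition vanishing_preserving ::
  "((real \<Rightarrow>\<^sub>C 'a::real_normed_vector) \<Rightarrow> (real \<Rightarrow>\<^sub>C 'b::real_normed_vector)) \<Rightarrow> bool" where
  "vanishing_preserving T \<longleftrightarrow> bounded_linear T \<and>
     (\<forall>g. (apply_bcontfun g \<longlongrightarrow> 0) at_top \<longrightarrow> (apply_bcontfun (T g) \<longlongrightarrow> 0) at_top)"

lemma vanishing_preserving_compose:
  assumes "vanishing_preserving S" "vanishing_preserving T"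
  shows "vanishing_preserving (\<lambda>g. S (T g))"
  using assms bounded_linear_compose unfolding vanishing_preserving_def by blast

lemma vanishing_preserving_zero: "vanishing_preserving (\<lambda>g. 0)"
  by (simp add: vanishing_preserving_def bounded_linear_zero)

lemma vanishing_preserving_add:
  assumes "vanishing_preserving S" "vanishing_preserving T"
  shows "vanishing_preserving (\<lambda>g. S g + T g)"
  using assms unfolding vanishing_preserving_def
  by (auto intro!: bounded_linear_add tendsto_add_zero)

lemma vanishing_preserving_sum:
  assumes "finite I" "\<And>i. i \<in> I \<Longrightarrow> vanishing_preserving (T i)"
  shows "vanishing_preserving (\<lambda>g. \<Sum>i\<in>I. T i g)"
  using assms
  by (induction I) (auto intro: vanishing_preserving_zero vanishing_preserving_add)

definition bcomp :: "('a::real_normed_vector \<Rightarrow> 'b::real_normed_vector) \<Rightarrow>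
    (real \<Rightarrow>\<^sub>C 'a) \<Rightarrow> (real \<Rightarrow>\<^sub>C 'b)" where
  "bcomp B g = Bcontfun (\<lambda>t. B (g t))"

lemma
  assumes "bounded_linear B"
  shows bcomp_apply: "apply_bcontfun (bcomp B g) t = B (g t)"
    and vanishing_preserving_bcomp: "vanishing_preserving (bcomp B)"
proof -
  interpret bounded_linear B by fact
  obtain K where K: "K > 0" "\<And>x. norm (B x) \<le> norm x * K" using pos_bounded by blast
  have "continuous_on UNIV (\<lambda>t. B (apply_bcontfun g t))" for g :: "real \<Rightarrow>\<^sub>C 'a"
    by (intro continuous_on continuous_on_apply_bcontfun)
  moreover have "norm (B (apply_bcontfun g t)) \<le> norm g * K" for g :: "real \<Rightarrow>\<^sub>C 'a" and t
    by (rule order_trans[OF K(2)]) (use K norm_bounded[of g t] in \<open>simp add: mult_right_mono\<close>)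
  ultimately have "bounded_linear (bcomp B)"
    and ap: "\<And>g. apply_bcontfun (bcomp B g) = (\<lambda>t. B (g t))"
    using bounded_linear_bcontfunI[of "\<lambda>g t. B (apply_bcontfun g t)" K]
    by (simp_all add: bcomp_def[abs_def] add scaleR)
  moreover have "((\<lambda>t. B (apply_bcontfun g t)) \<longlongrightarrow> 0) at_top"
    if "(apply_bcontfun g \<longlongrightarrow> 0) at_top" for g
    using tendsto[OF that] by (simp add: zero)
  ultimately show "vanishing_preserving (bcomp B)"
    unfolding vanishing_preserving_def by simp blast
  show "apply_bcontfun (bcomp B g) t = B (g t)" by (simp add: ap)
qed

lemma scalar_bounded_solution:
  fixes \<mu> :: complex
  assumes "Re \<mu> \<noteq> 0"
  obtains T :: "(real \<Rightarrow>\<^sub>C complex) \<Rightarrow> (real \<Rightarrow>\<^sub>C complex)"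
  where "vanishing_preserving T"
    and "\<And>g t. (T g has_vector_derivative \<mu> * T g t + g t) (at t)"
proof -
  \<comment> \<open>The only bounded solution integrates from \<open>+\<infinity>\<close> if \<open>Re \<mu> > 0\<close> and from \<open>-\<infinity>\<close> if
    \<open>Re \<mu> < 0\<close>; the sign \<open>e\<close> treats both cases at once.\<close>
  define e where "e = sgn (Re \<mu>)"
  define a where "a = \<bar>Re \<mu>\<bar>"
  have a: "a > 0" using assms by (simp add: a_def)
  have e: "e = 1 \<or> e = - 1" using assms by (auto simp: e_def sgn_if)
  have ea: "e * Re \<mu> = a" by (simp add: e_def a_def sgn_if)
  define w where "w u = indicator {0..} u * exp (- a * u)" for u :: real
  have w: "integrable lborel w"
    unfolding w_def[abs_def] by (rule integrable_exp_minus_atLeast[OF a])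
  \<comment> \<open>The integrand of the Green's function is written in the distance
    \<open>u\<close> from \<open>t\<close>, so that its majorant \<open>w u * norm g\<close> does
    not depend on \<open>t\<close>. This gives the uniform bound as well as dominated convergence as
    \<open>t\<close> grows.\<close>
  define k where "k g t u = indicator {0..} u *\<^sub>R (exp (- (of_real (e * u)) * \<mu>) * g (t + e * u))"
    for g :: "real \<Rightarrow> complex" and t u :: real
  define T where "T g t = - e *\<^sub>R (LINT u|lborel. k (apply_bcontfun g) t u)"
    for g :: "real \<Rightarrow>\<^sub>C complex" and t
  have nk: "norm (k g t u) = w u * norm (g (t + e * u))" for g t u
    using ea by (auto simp: k_def w_def norm_mult indicator_def algebra_simps)
  have gm: "apply_bcontfun g \<in> borel_measurable borel" for g :: "real \<Rightarrow>\<^sub>C complex"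
    by (intro borel_measurable_continuous_onI) auto
  have km: "k (apply_bcontfun g) t \<in> borel_measurable lborel" for g t
    unfolding k_def[abs_def] using gm[of g] by measurable
  have nkw: "norm (k (apply_bcontfun g) t u) \<le> w u * norm g" for g t u
    unfolding nk by (rule mult_left_mono) (auto simp: w_def norm_bounded)
  have ki: "integrable lborel (k (apply_bcontfun g) t)" for g t
    by (rule Bochner_Integration.integrable_bound[OF _ km, where f="\<lambda>u. w u * norm g"])
      (use w in \<open>auto intro!: AE_I2 order_trans[OF nkw]\<close>)
  have bound: "norm (T g t) \<le> norm g * (LINT u|lborel. w u)" for g t
  proof -
    have "norm (T g t) = norm (LINT u|lborel. k g t u)"
      using e by (auto simp: T_def)
    also have "\<dots> \<le> (LINT u|lborel. w u * norm g)"
      by (rule Bochner_Integration.integral_norm_bound_integral) (use ki w nkw in auto)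
    finally show ?thesis by (simp add: mult.commute)
  qed
  have deriv: "(T g has_vector_derivative \<mu> * T g t + g t) (at t)" for g t
  proof -
    \<comment> \<open>For differentiation the variable \<open>t\<close> has to leave the integrand
      and enter the limit of integration. Reflecting time by \<open>e\<close> turns both signs of
      \<open>Re \<mu>\<close> into a tail integral of \<open>H\<close> over
      \<open>{e * t..}\<close>.\<close>
    define H where "H s = exp (- of_real (e * s) * \<mu>) * g (e * s)" for s
    have cH: "continuous_on UNIV H"
      unfolding H_def by (intro continuous_intros continuous_on_compose2[OF continuous_on_apply_bcontfun[of UNIV]]) auto
    \<comment> \<open>The factor \<open>1\<close> in \<open>1 * u\<close> fits the shape
      \<open>t + c * x\<close> of the affine substitution rule for \<open>lborel\<close>.\<close>
    have kH: "k g t u = exp (of_real t * \<mu>) * (indicator {e * t..} (e * t + 1 * u) *\<^sub>R H (e * t + 1 * u))"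
      for t u
    proof -
      have "e * (e * t + u) = t + e * u" using e by auto
      moreover have "exp (of_real t * \<mu>) * exp (- of_real (t + e * u) * \<mu>) = exp (- of_real (e * u) * \<mu>)"
        by (simp add: exp_add[symmetric] algebra_simps)
      ultimately show ?thesis unfolding k_def H_def by (auto simp: indicator_def)
    qed
    have kH': "indicator {e * t..} (e * t + 1 * u) *\<^sub>R H (e * t + 1 * u) = exp (- of_real t * \<mu>) * k g t u" for t u
      unfolding kH by (simp add: exp_minus)
    have intH: "set_integrable lborel {s..} H" for s
    proof -
      have "integrable lborel (\<lambda>u. indicator {e * (e * s)..} (e * (e * s) + 1 * u) *\<^sub>R H (e * (e * s) + 1 * u))"
        unfolding kH' using ki[of g] by auto
      then show ?thesis using e
        by (subst (asm) lborel_integrable_real_affine_iff) (auto simp: set_integrable_def)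
    qed
    have Teq: "T g t = - e *\<^sub>R (exp (of_real t * \<mu>) * (LINT s:{e * t..}|lborel. H s))" for t
    proof -
      have "(LINT u|lborel. k g t u) = exp (of_real t * \<mu>) *
           (LINT u|lborel. indicator {e * t..} (e * t + 1 * u) *\<^sub>R H (e * t + 1 * u))"
        unfolding kH by (rule integral_mult_right_zero)
      also have "(LINT u|lborel. indicator {e * t..} (e * t + 1 * u) *\<^sub>R H (e * t + 1 * u))
          = (LINT s:{e * t..}|lborel. H s)"
        unfolding set_lebesgue_integral_def
        by (subst lborel_integral_real_affine[where c=1 and t="e * t"]) auto
      finally show ?thesis by (simp add: T_def)
    qed
    define J where "J t = (LINT s:{t..}|lborel. H s)" for t
    have J: "(J has_vector_derivative - H s) (at s)" for s
      unfolding J_def[abs_def] by (rule has_vector_derivative_tail_integral[OF cH intH])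
    have TJ: "T g = (\<lambda>t. - e *\<^sub>R (exp (of_real t * \<mu>) * J (e * t)))"
      by (rule ext) (simp only: Teq J_def)
    have lin: "((\<lambda>t. e * t) has_vector_derivative e) (at t)"
      by (auto intro!: derivative_eq_intros)
    have "((\<lambda>t. J (e * t)) has_vector_derivative e *\<^sub>R (- H (e * t))) (at t)"
      using vector_diff_chain_at[OF lin J] by (simp add: o_def)
    moreover have "((\<lambda>t. exp (of_real t * \<mu>)) has_vector_derivative exp (of_real t * \<mu>) * \<mu>) (at t)"
      using exp_scaleR_has_vector_derivative_right[of \<mu> t UNIV] by (simp add: scaleR_conv_of_real)
    ultimately have "((\<lambda>t. - e *\<^sub>R (exp (of_real t * \<mu>) * J (e * t))) has_vector_derivative
        - e *\<^sub>R (exp (of_real t * \<mu>) * (e *\<^sub>R (- H (e * t))) + exp (of_real t * \<mu>) * \<mu> * J (e * t))) (at t)"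
      by (auto intro!: derivative_eq_intros)
    also have "- e *\<^sub>R (exp (of_real t * \<mu>) * (e *\<^sub>R (- H (e * t))) + exp (of_real t * \<mu>) * \<mu> * J (e * t))
        = \<mu> * T g t + g t"
    proof -
      have "e * (e * t) = t" using e by auto
      have "exp (of_real t * \<mu>) * H (e * t) = exp (of_real t * \<mu>) * (exp (- of_real t * \<mu>) * g t)"
        using \<open>e * (e * t) = t\<close> by (simp only: H_def)
      then have "exp (of_real t * \<mu>) * H (e * t) = g t"
        by (simp add: exp_minus)
      moreover have "T g t = - e *\<^sub>R (exp (of_real t * \<mu>) * J (e * t))"
        using Teq by (simp add: J_def)
      moreover have "- e *\<^sub>R (exp (of_real t * \<mu>) * (e *\<^sub>R (- H (e * t)))) = exp (of_real t * \<mu>) * H (e * t)"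
        using e by auto
      ultimately show ?thesis by (simp add: algebra_simps)
    qed
    finally show ?thesis
      by (simp only: TJ[symmetric])
  qed
  have van: "(T g \<longlongrightarrow> 0) at_top" if g: "(apply_bcontfun g \<longlongrightarrow> 0) at_top" for g
  proof -
    have "((\<lambda>t. LINT u|lborel. k g t u) \<longlongrightarrow> (LINT u::real|lborel. (0::complex))) at_top"
    proof (rule integral_dominated_convergence_at_top[where s="\<lambda>t u. k g t u" and w="\<lambda>u. w u * norm g"])
      show "integrable lborel (\<lambda>u. w u * norm g)" using w by simp
      show "\<forall>\<^sub>F t in at_top. AE u in lborel. norm (k g t u) \<le> w u * norm g"
        by (intro always_eventually allI AE_I2 nkw)
      show "AE u in lborel. ((\<lambda>t. k g t u) \<longlongrightarrow> 0) at_top"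
      proof (rule AE_I2)
        fix u
        have "filterlim (\<lambda>t. e * u + t) at_top at_top"
          by (rule filterlim_tendsto_add_at_top[OF tendsto_const filterlim_ident])
        from filterlim_compose[OF g this] have "((\<lambda>t. g (t + e * u)) \<longlongrightarrow> 0) at_top"
          by (simp add: add.commute)
        from tendsto_mult[OF tendsto_const[of "w u"] tendsto_norm_zero[OF this]]
        have "((\<lambda>t. norm (k g t u)) \<longlongrightarrow> 0) at_top"
          unfolding nk by simp
        then show "((\<lambda>t. k g t u) \<longlongrightarrow> 0) at_top"
          by (rule tendsto_norm_zero_cancel)
      qed
      show "(\<lambda>u. k g t u) \<in> borel_measurable lborel" for t
        by (rule km)
    qed simp
    then have "((\<lambda>t. LINT u|lborel. k g t u) \<longlongrightarrow> 0) at_top" by simp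
    from tendsto_scaleR[OF tendsto_const[of "- e"] this]
    show ?thesis unfolding T_def[abs_def] by simp
  qed
  have cont: "continuous_on UNIV (T g)" for g
    by (intro continuous_at_imp_continuous_on ballI has_vector_derivative_continuous[OF deriv])
  have add: "T (g + h) t = T g t + T h t" for g h t
  proof -
    have "k (apply_bcontfun (g + h)) t u = k g t u + k h t u" for u
      by (simp add: k_def algebra_simps)
    then show ?thesis using ki[of g] ki[of h] by (simp add: T_def algebra_simps)
  qed
  have scale: "T (c *\<^sub>R g) t = c *\<^sub>R T g t" for c g t
  proof -
    have "k (apply_bcontfun (c *\<^sub>R g)) t u = c *\<^sub>R k g t u" for u
      by (simp add: k_def)
    then show ?thesis by (simp add: T_def)
  qed
  note T = bounded_linear_bcontfunI[of T, OF cont add scale bound]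
  show ?thesis
  proof (rule that[of "\<lambda>g. Bcontfun (T g)"])
    show "vanishing_preserving (\<lambda>g. Bcontfun (T g))"
      unfolding vanishing_preserving_def using T van by simp
    show "(Bcontfun (T g) has_vector_derivative \<mu> * Bcontfun (T g) t + g t) (at t)" for g t
      using deriv T by simp
  qed
qed

text \<open>\<open>p(A) M\<close> in Horner form.\<close>
definition poly_matrix :: "complex^'n::finite^'n \<Rightarrow> complex^'n^'n \<Rightarrow> complex poly \<Rightarrow> complex^'n::finite^'n" where
  "poly_matrix A M p = fold_coeffs (\<lambda>a X. mat a ** M + A ** X) p 0"

section \<open>Polynomials in a matrix and an annihilating polynomial\<close>

lemma mat_mult_nth: "(mat c ** X) $ i $ j = (c::complex) * X $ i $ j"
  by (simp add: matrix_matrix_mult_def mat_def if_distrib[of "\<lambda>x. x * _"] cong: if_cong)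

lemma mult_mat_nth: "(X ** mat c) $ i $ j = (c::complex) * X $ i $ j"
  by (simp add: matrix_matrix_mult_def mat_def if_distrib[of "\<lambda>x. _ * x"] mult.commute cong: if_cong)

lemma mat_mult_commute: "mat c ** X = X ** mat (c::complex)"
  by (simp add: vec_eq_iff mat_mult_nth mult_mat_nth)

lemma matrix_mult_0_right: "A ** 0 = (0 :: complex^'n^'m)"
  by (simp add: matrix_matrix_mult_def vec_eq_iff)

lemma matrix_add_rdistrib: "(A + B) ** C = A ** C + B ** (C :: complex^'n^'m)"
  by (simp add: matrix_matrix_mult_def vec_eq_iff distrib_right sum.distrib)

lemma matrix_sub_rdistrib: "(A - B) ** C = A ** C - B ** (C :: complex^'n^'m)"
  by (simp add: matrix_matrix_mult_def vec_eq_iff left_diff_distrib sum_subtractf)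

lemma matrix_sub_ldistrib: "A ** (B - C) = A ** B - A ** (C :: complex^'n^'m)"
  by (simp add: matrix_matrix_mult_def vec_eq_iff right_diff_distrib sum_subtractf)

lemma mat_add: "mat (a + b) = mat a + (mat b :: complex^'n^'n)"
  by (simp add: vec_eq_iff mat_def)

lemma mat_mult: "mat (a * b) = mat a ** (mat b :: complex^'n::finite^'n)"
  by (simp add: vec_eq_iff mat_mult_nth) (simp add: mat_def)

lemma mat_mult_vec: "mat c *v v = (c::complex) *s v"
  by (simp add: matrix_vector_mult_def vec_eq_iff mat_def if_distrib[of "\<lambda>x. x * _"] cong: if_cong)

lemma poly_matrix_0 [simp]: "poly_matrix A M 0 = 0"
  by (simp add: poly_matrix_def)

lemma poly_matrix_pCons: "poly_matrix A M (pCons a p) = mat a ** M + A ** poly_matrix A M p"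
proof (cases "p = 0 \<and> a = 0")
  case True
  then show ?thesis by (simp add: vec_eq_iff mat_mult_nth matrix_mult_0_right)
next
  case False
  then show ?thesis by (auto simp: poly_matrix_def)
qed

lemma poly_matrix_add: "poly_matrix A M (p + q) = poly_matrix A M p + poly_matrix A M q"
proof (induction p arbitrary: q)
  case (pCons a p)
  show ?case
  proof (cases q)
    case (pCons b q')
    then show ?thesis
      by (simp add: poly_matrix_pCons pCons.IH mat_add matrix_add_ldistrib matrix_add_rdistrib)
  qed
qed simp

lemma poly_matrix_smult: "poly_matrix A M (smult c p) = mat c ** poly_matrix A M p"
proof (induction p)
  case 0
  then show ?case by (simp add: matrix_mult_0_right)
next
  case (pCons a p)
  then show ?case
    by (simp add: poly_matrix_pCons mat_mult matrix_add_ldistrib matrix_mul_assoc)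
      (simp add: mat_mult_commute[of c A])
qed

lemma poly_matrix_shift: "poly_matrix A (A ** M) p = A ** poly_matrix A M p"
proof (induction p)
  case 0
  then show ?case by (simp add: matrix_mult_0_right)
next
  case (pCons a p)
  then show ?case
    by (simp add: poly_matrix_pCons matrix_add_ldistrib matrix_mul_assoc mat_mult_commute[of a A])
qed

lemma poly_matrix_diff_right: "poly_matrix A (M - N) p = poly_matrix A M p - poly_matrix A N p"
  by (induction p) (auto simp: poly_matrix_pCons matrix_sub_ldistrib)

lemma poly_matrix_mat: "poly_matrix A (mat c ** M) p = mat c ** poly_matrix A M p"
proof (induction p)
  case 0
  then show ?case by (simp add: matrix_mult_0_right)
next
  case (pCons a p)
  then show ?case
    by (simp add: poly_matrix_pCons matrix_add_ldistrib matrix_mul_assoc mat_mult_commute[of c A])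
      (metis mat_mult mult.commute)
qed

text \<open>Both sides reduce to the same product because \<open>A - mat z\<close> commutes with
  every polynomial in \<open>A\<close>. Together the two equations move a linear factor from the
  polynomial onto \<open>M\<close>, which lowers the degree in the later induction.\<close>

lemma poly_matrix_linear_factor:
  shows "poly_matrix A M ([:- z, 1:] * q) = (A - mat z) ** poly_matrix A M q"
    and "poly_matrix A ((A - mat z) ** M) q = (A - mat z) ** poly_matrix A M q"
proof -
  have eq: "[:- z, 1:] * q = pCons 0 q + smult (- z) q" by simp
  have m0: "mat 0 ** X = 0" "mat (- z) ** X = - (mat z ** X)" for X :: "complex^'a^'a"
    by (simp_all add: vec_eq_iff mat_mult_nth)
  show "poly_matrix A M ([:- z, 1:] * q) = (A - mat z) ** poly_matrix A M q"
    unfolding eq poly_matrix_add poly_matrix_smult poly_matrix_pCons m0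
    by (simp add: matrix_sub_rdistrib)
  show "poly_matrix A ((A - mat z) ** M) q = (A - mat z) ** poly_matrix A M q"
    by (simp add: matrix_sub_rdistrib poly_matrix_diff_right poly_matrix_shift poly_matrix_mat)
qed

text \<open>More vectors than the dimension are dependent. The relation is indexed by numbers, not
  by a set of vectors, because the family may repeat itself; a repetition is itself a relation, with
  coefficients 1 and -1.\<close>

lemma nontrivial_relation:
  fixes x :: "nat \<Rightarrow> 'a::euclidean_space"
  obtains u :: "nat \<Rightarrow> real" and N i where "i \<le> N" "u i \<noteq> 0" "(\<Sum>i\<le>N. u i *\<^sub>R x i) = 0"
proof -
  define N where "N = DIM('a)"
  show ?thesis
  proof (cases "inj_on x {..N}")
    case True
    then have "card (x ` {..N}) = Suc N" by (simp add: card_image)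
    then have "dependent (x ` {..N})"
      by (intro dependent_biggerset) (auto simp: N_def)
    then have "\<exists>u. (\<exists>v\<in>x ` {..N}. u v \<noteq> 0) \<and> (\<Sum>v\<in>x ` {..N}. u v *\<^sub>R v) = 0"
      using dependent_finite[of "x ` {..N}"] by simp
    then obtain u where u: "\<exists>v\<in>x ` {..N}. u v \<noteq> 0" "(\<Sum>v\<in>x ` {..N}. u v *\<^sub>R v) = 0"
      by blast
    from u(1) obtain i where "i \<le> N" "u (x i) \<noteq> 0" by auto
    moreover have "(\<Sum>i\<le>N. u (x i) *\<^sub>R x i) = 0"
      using u(2) by (simp add: sum.reindex[OF True] o_def)
    ultimately show ?thesis by (rule that[where u="\<lambda>i. u (x i)"])
  next
    case False
    then obtain i j where ij: "i \<le> N" "j \<le> N" "i \<noteq> j" "x i = x j" by (auto simp: inj_on_def)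
    define u :: "nat \<Rightarrow> real" where "u l = (if l = i then 1 else 0) - (if l = j then 1 else 0)" for l
    have "u l *\<^sub>R x l = (if l = i then x l else 0) - (if l = j then x l else 0)" for l
      by (simp add: u_def)
    then have "(\<Sum>l\<le>N. u l *\<^sub>R x l) = 0"
      using ij by (simp add: sum_subtractf)
    then show ?thesis using that[of i N u] ij by (auto simp: u_def)
  qed
qed

text \<open>The matrices form a space of finite real dimension, so the powers of \<open>A\<close>
  satisfy a linear relation. Any annihilator will do: roots that are not eigenvalues are discarded
  when the factors are removed.\<close>

lemma annihilating_poly:
  fixes A :: "complex^'n::finite^'n"
  obtains p where "p \<noteq> 0" "poly_matrix A (mat 1) p = 0"
proof -
  define P where "P i = ((\<lambda>X. A ** X) ^^ i) (mat 1)" for i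
  obtain u N i where u: "i \<le> N" "u i \<noteq> 0" "(\<Sum>i\<le>N. u i *\<^sub>R P i) = 0"
    by (rule nontrivial_relation)
  define p where "p = (\<Sum>i\<le>N. monom (complex_of_real (u i)) i)"
  have "poly_matrix A (mat 1) (monom (of_real c) i) = c *\<^sub>R P i" for c i
  proof (induction i)
    case 0
    then show ?case
      by (simp add: monom_0 poly_matrix_pCons P_def)
        (simp add: vec_eq_iff mat_mult_nth, simp add: mat_def complex_eq_iff)
  next
    case (Suc i)
    have "A ** (c *\<^sub>R P i) = c *\<^sub>R (A ** P i)"
      by (simp add: matrix_matrix_mult_def vec_eq_iff scaleR_sum_right)
    moreover have "mat 0 ** X = 0" for X :: "complex^'n::finite^'n"
      by (simp add: vec_eq_iff mat_mult_nth)
    ultimately show ?case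
      using Suc by (simp add: monom_Suc poly_matrix_pCons P_def)
  qed
  moreover have "poly_matrix A (mat 1) (sum g I) = (\<Sum>i\<in>I. poly_matrix A (mat 1) (g i))" for I :: "nat set" and g
    by (induction I rule: infinite_finite_induct) (auto simp: poly_matrix_add)
  ultimately have "poly_matrix A (mat 1) p = 0"
    using u(3) by (simp add: p_def)
  moreover have "coeff p i = u i"
    using u(1) by (simp add: p_def coeff_sum if_distrib sum.delta cong: if_cong)
  then have "p \<noteq> 0" using u(2) by auto
  ultimately show ?thesis using that by blast
qed

section \<open>Reduction of the linear system to scalar equations\<close>

definition bounded_solver :: "complex^'n::finite^'n \<Rightarrow> complex^'n^'n \<Rightarrow>
    ((real \<Rightarrow>\<^sub>C (complex^'n::finite)) \<Rightarrow> (real \<Rightarrow>\<^sub>C (complex^'n))) \<Rightarrow> bool" where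
  "bounded_solver A M T \<longleftrightarrow> vanishing_preserving T \<and>
     (\<forall>g t. (T g has_vector_derivative A *v T g t + M *v g t) (at t))"

lemma bounded_linear_matrix_vector_complex: "bounded_linear ((*v) (M :: complex^'n::finite^'m::finite))"
  unfolding linear_conv_bounded_linear[symmetric]
  by (rule linearI)
    (simp_all add: matrix_vector_mult_def vec_eq_iff algebra_simps sum.distrib scaleR_sum_right)

lemma bounded_linear_axis: "bounded_linear (axis (i::'n::finite) :: complex \<Rightarrow> complex^'n)"
  unfolding linear_conv_bounded_linear[symmetric]
  by (rule linearI) (simp_all add: axis_def vec_eq_iff)

text \<open>Let V' = z V + g, solved component by component, and try T g = M V + W. Then W has to
  satisfy W' = A W + (A - z) M V, and the given solver, applied to V, supplies it. The factor
  \<open>M\<close> in front of the forcing is thus the parameter of the induction: it starts as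
  \<open>mat 1\<close>, collects factors \<open>A - mat z\<close>, and the problem is trivial once
  it is 0.\<close>

lemma bounded_solver_step:
  fixes A M :: "complex^'n::finite^'n"
  assumes "Re z \<noteq> 0" and T': "bounded_solver A ((A - mat z) ** M) T'"
  shows "\<exists>T. bounded_solver A M T"
proof -
  obtain S where S: "vanishing_preserving S"
    and dS: "\<And>g t. (S g has_vector_derivative z * S g t + g t) (at t)"
    using scalar_bounded_solution[OF \<open>Re z \<noteq> 0\<close>] by blast
  define V where "V g = (\<Sum>i\<in>UNIV. bcomp (axis i) (S (bcomp (\<lambda>v. v $ i) g)))"
    for g :: "real \<Rightarrow>\<^sub>C (complex^'n)"
  have "vanishing_preserving (\<lambda>g. bcomp (axis i) (S (bcomp (\<lambda>v::complex^'n. v $ i) g)))" for i :: 'n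
    by (rule vanishing_preserving_compose[OF vanishing_preserving_bcomp[OF bounded_linear_axis]
          vanishing_preserving_compose[OF S vanishing_preserving_bcomp[OF bounded_linear_vec_nth]]])
  then have V: "vanishing_preserving V"
    unfolding V_def[abs_def] by (rule vanishing_preserving_sum[OF finite])
  have apV: "apply_bcontfun (V g) = (\<lambda>t. \<Sum>i\<in>UNIV. axis i (S (bcomp (\<lambda>v. v $ i) g) t))" for g
  proof -
    have "apply_bcontfun (sum h I) = (\<lambda>t. \<Sum>i\<in>I. h i t)" for h :: "'n \<Rightarrow> real \<Rightarrow>\<^sub>C (complex^'n)" and I
      by (induction I rule: infinite_finite_induct) (auto simp: fun_eq_iff)
    then show ?thesis
      by (simp add: V_def bcomp_apply[OF bounded_linear_axis])
  qed
  have dV: "(V g has_vector_derivative mat z *v V g t + g t) (at t)" for g t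
  proof -
    have "((\<lambda>t. \<Sum>i\<in>UNIV. axis i (S (bcomp (\<lambda>v. v $ i) g) t)) has_vector_derivative
        (\<Sum>i\<in>UNIV. axis i (z * S (bcomp (\<lambda>v. v $ i) g) t + bcomp (\<lambda>v. v $ i) g t))) (at t)"
      by (intro has_vector_derivative_sum bounded_linear.has_vector_derivative[OF bounded_linear_axis] dS)
    moreover have "(\<Sum>i\<in>UNIV. axis i (z * S (bcomp (\<lambda>v. v $ i) g) t + bcomp (\<lambda>v. v $ i) g t))
        = mat z *v V g t + g t"
      unfolding apV bcomp_apply[OF bounded_linear_vec_nth]
      by (simp add: mat_mult_vec vec_eq_iff axis_def)
    ultimately show ?thesis unfolding apV by simp
  qed
  define T where "T g = bcomp ((*v) M) (V g) + T' (V g)" for g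
  have "vanishing_preserving T'" using T' by (simp add: bounded_solver_def)
  then have "vanishing_preserving T"
    unfolding T_def[abs_def]
    by (rule vanishing_preserving_add[OF
          vanishing_preserving_compose[OF vanishing_preserving_bcomp[OF bounded_linear_matrix_vector_complex] V]
          vanishing_preserving_compose[OF _ V]])
  moreover have "(T g has_vector_derivative A *v T g t + M *v g t) (at t)" for g t
  proof -
    have apT: "apply_bcontfun (T g) = (\<lambda>t. M *v V g t + T' (V g) t)"
      by (auto simp: T_def bcomp_apply[OF bounded_linear_matrix_vector_complex] fun_eq_iff)
    have "((\<lambda>t. M *v V g t + T' (V g) t) has_vector_derivative
        M *v (mat z *v V g t + g t) + (A *v T' (V g) t + ((A - mat z) ** M) *v V g t)) (at t)"
      using T' unfolding bounded_solver_def
      by (intro has_vector_derivative_add dV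
          bounded_linear.has_vector_derivative[OF bounded_linear_matrix_vector_complex]) auto
    also have "M *v (mat z *v V g t + g t) + (A *v T' (V g) t + ((A - mat z) ** M) *v V g t)
       = A *v T g t + M *v g t"
      by (simp add: apT matrix_vector_right_distrib matrix_vector_mult_diff_rdistrib
          matrix_sub_rdistrib matrix_vector_mul_assoc mat_mult_commute[of z M])
    finally show ?thesis unfolding apT .
  qed
  ultimately show ?thesis unfolding bounded_solver_def by blast
qed

lemma matrix_mult_eq_0_imp:
  fixes B X :: "complex^'n::finite^'n"
  assumes "B ** X = 0" "\<And>v. B *v v = 0 \<Longrightarrow> v = 0"
  shows "X = 0"
proof -
  have "X *v w = 0" for w
    by (rule assms(2)) (simp add: matrix_vector_mul_assoc assms(1))
  then show ?thesis by (simp add: matrix_eq)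
qed

text \<open>Factors \<open>A - z\<close> of the annihilator are removed one at a time: it is injective if \<open>z\<close> is no
  eigenvalue, and otherwise \<open>Re z \<noteq> 0\<close> and the problem for \<open>M\<close> reduces to that for \<open>(A - z) M\<close>.\<close>
lemma bounded_solver_exists:
  fixes A M :: "complex^'n::finite^'n"
  assumes hyp: "\<And>z v. v \<noteq> 0 \<Longrightarrow> A *v v = z *s v \<Longrightarrow> Re z \<noteq> 0"
    and "p \<noteq> 0" "poly_matrix A M p = 0"
  shows "\<exists>T. bounded_solver A M T"
  using assms(2,3)
proof (induction "degree p" arbitrary: p M)
  case 0
  then obtain a where p: "p = [:a:]" "a \<noteq> 0" by (metis degree_0_id pCons_0_0)
  have "A ** 0 = (0 :: complex^'n^'n)" by (simp add: matrix_matrix_mult_def vec_eq_iff)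
  then have "mat a ** M = 0" using 0 p by (simp add: poly_matrix_pCons)
  then have M: "M = 0"
    by (rule matrix_mult_eq_0_imp)
      (use p in \<open>simp add: mat_mult_vec\<close>)
  show ?case
    by (rule exI[of _ "\<lambda>g. 0"]) (auto simp: bounded_solver_def vanishing_preserving_zero M zero_bcontfun.rep_eq)
next
  case (Suc d)
  then have "\<not> constant (poly p)" using constant_degree[of p] by simp
  then obtain z where "poly p z = 0" using fundamental_theorem_of_algebra by blast
  then obtain q where q: "p = [:- z, 1:] * q" by (auto simp: poly_eq_0_iff_dvd)
  then have q0: "q \<noteq> 0" using Suc by auto
  then have dq: "d = degree q" using Suc(2) unfolding q by (subst (asm) degree_mult_eq) auto
  have Aq: "(A - mat z) ** poly_matrix A M q = 0"
    using Suc(4) unfolding q poly_matrix_linear_factor(1) .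
  have ev: "(A - mat z) *v v = 0 \<longleftrightarrow> A *v v = z *s v" for v
    by (simp add: matrix_vector_mult_diff_rdistrib mat_mult_vec)
  show ?case
  proof (cases "\<exists>v. v \<noteq> 0 \<and> A *v v = z *s v")
    case True
    then have "Re z \<noteq> 0" using hyp by blast
    moreover have "\<exists>T. bounded_solver A ((A - mat z) ** M) T"
      by (rule Suc(1)[OF dq q0]) (simp add: poly_matrix_linear_factor(2) Aq)
    ultimately show ?thesis using bounded_solver_step by blast
  next
    case False
    have "poly_matrix A M q = 0"
      by (rule matrix_mult_eq_0_imp[OF Aq]) (use False ev in blast)
    then show ?thesis by (rule Suc(1)[OF dq q0])
  qed
qed

text \<open>The real forcing is solved over the complex numbers and the real part is taken; since
  \<open>A\<close> is real, taking real parts commutes with it.\<close>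

lemma hyperbolic_bounded_solver:
  fixes A :: "real^'n::finite^'n"
  assumes "hyperbolic_matrix A"
  obtains L :: "(real \<Rightarrow>\<^sub>C (real^'n)) \<Rightarrow> (real \<Rightarrow>\<^sub>C (real^'n))"
  where "vanishing_preserving L"
    and "\<And>g t. (L g has_vector_derivative A *v L g t + g t) (at t)"
proof -
  define C where "C = map_matrix complex_of_real A"
  have "Re z \<noteq> 0" if "v \<noteq> 0" "C *v v = z *s v" for z v
    using assms that unfolding hyperbolic_matrix_def Spec_def C_def by blast
  then obtain T where T: "bounded_solver C (mat 1) T"
    using annihilating_poly[of C] bounded_solver_exists[of C] by metis
  define R I where "R v = (\<chi> i. Re (v $ i))" and "I w = (\<chi> i. complex_of_real (w $ i))"
    for v :: "complex^'n" and w :: "real^'n"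
  have R: "bounded_linear R" and I: "bounded_linear I"
    unfolding linear_conv_bounded_linear[symmetric]
    by (auto intro!: linearI simp: R_def I_def vec_eq_iff complex_eq_iff)
  have RC: "R (C *v v) = A *v R v" for v
    by (simp add: R_def C_def matrix_vector_mult_def vec_eq_iff map_matrix_def)
  have RI: "R (I w) = w" for w by (simp add: R_def I_def)
  show ?thesis
  proof (rule that[of "\<lambda>g. bcomp R (T (bcomp I g))"])
    have "vanishing_preserving T" using T by (simp add: bounded_solver_def)
    then show "vanishing_preserving (\<lambda>g. bcomp R (T (bcomp I g)))"
      by (intro vanishing_preserving_compose[OF vanishing_preserving_bcomp[OF R]]
          vanishing_preserving_compose[OF _ vanishing_preserving_bcomp[OF I]])
    show "(bcomp R (T (bcomp I g)) has_vector_derivative A *v bcomp R (T (bcomp I g)) t + g t) (at t)" for g t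
    proof -
      have "((\<lambda>t. R (T (bcomp I g) t)) has_vector_derivative
          R (C *v T (bcomp I g) t + mat 1 *v bcomp I g t)) (at t)"
        using T unfolding bounded_solver_def
        by (intro bounded_linear.has_vector_derivative[OF R]) blast
      moreover have "apply_bcontfun (bcomp R (T (bcomp I g))) = (\<lambda>t. R (T (bcomp I g) t))"
        by (simp add: fun_eq_iff bcomp_apply[OF R])
      ultimately show ?thesis
        by (simp add: linear_add[OF bounded_linear.linear[OF R]] RC bcomp_apply[OF I] RI)
    qed
  qed
qed

section \<open>Small perturbations of a hyperbolic linear equation\<close>

text \<open>Uniform limits preserve decay. With this the fixed point can be sought in a complete set
  of decaying functions, so its decay needs no separate argument.\<close>

lemma closed_vanishing_bcontfun:
  "closed {z :: real \<Rightarrow>\<^sub>C 'a::real_normed_vector. (apply_bcontfun z \<longlongrightarrow> 0) at_top}"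
  unfolding closed_sequential_limits
proof (intro allI impI, elim conjE)
  fix x :: "nat \<Rightarrow> real \<Rightarrow>\<^sub>C 'a" and l
  assume x: "\<forall>n. x n \<in> {z. (apply_bcontfun z \<longlongrightarrow> 0) at_top}" and l: "x \<longlonglongrightarrow> l"
  have "(apply_bcontfun l \<longlongrightarrow> 0) at_top"
  proof (rule tendstoI)
    fix e :: real assume "e > 0"
    then have "\<forall>\<^sub>F n in sequentially. dist (x n) l < e / 2"
      using tendstoD[OF l, of "e / 2"] by simp
    then obtain n where n: "dist (x n) l < e / 2"
      using eventually_happens by force
    have "(apply_bcontfun (x n) \<longlongrightarrow> 0) at_top" using x by simp
    then have "\<forall>\<^sub>F t in at_top. dist (x n t) 0 < e / 2"
      using \<open>e > 0\<close> by (intro tendstoD) auto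
    then show "\<forall>\<^sub>F t in at_top. dist (l t) 0 < e"
    proof eventually_elim
      case (elim t)
      have "dist (l t) 0 \<le> dist (x n t) (l t) + dist (x n t) 0"
        by (metis dist_commute dist_triangle)
      with elim n dist_bounded[of "x n" t l] show ?case by linarith
    qed
  qed
  then show "l \<in> {z. (apply_bcontfun z \<longlongrightarrow> 0) at_top}" by simp
qed

text \<open>A solution is a fixed point of z -> L(N(., z)). The estimate |N(t, z)| <= |N(t, 0)| +
  \<eta> |z| shows that the forcing inherits decay from z, without any rate. The constant
  \<open>\<eta>\<close> is quantified before \<open>N\<close> and \<open>\<rho>\<close>: it depends
  on \<open>A\<close> alone, and the nonlinearity is adapted to it afterwards.\<close>

lemma vanishing_solution_of_perturbation:
  fixes A :: "real^'n::finite^'n"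
  assumes "hyperbolic_matrix A"
  shows "\<exists>\<eta>::real. \<eta> > 0 \<and> (\<forall>(N :: real \<Rightarrow> real^'n \<Rightarrow> real^'n) \<rho>. \<rho> > 0 \<longrightarrow>
      (\<forall>z. continuous_on UNIV z \<longrightarrow> (\<forall>t. norm (z t) \<le> \<rho>) \<longrightarrow> continuous_on UNIV (\<lambda>t. N t (z t))) \<longrightarrow>
      (\<forall>t v w. norm v \<le> \<rho> \<longrightarrow> norm w \<le> \<rho> \<longrightarrow> norm (N t v - N t w) \<le> \<eta> * norm (v - w)) \<longrightarrow>
      (\<forall>t. norm (N t 0) \<le> \<eta> * \<rho>) \<longrightarrow> ((\<lambda>t. N t 0) \<longlongrightarrow> 0) at_top \<longrightarrow>
      (\<exists>z. (\<forall>t. norm (z t) \<le> \<rho>) \<and> (z \<longlongrightarrow> 0) at_top \<and>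
        (\<forall>t. (z has_vector_derivative A *v z t + N t (z t)) (at t))))"
proof -
  obtain L where L: "vanishing_preserving L"
    and dL: "\<And>g t. (L g has_vector_derivative A *v L g t + g t) (at t)"
    by (rule hyperbolic_bounded_solver[OF assms]) blast
  interpret L: bounded_linear L using L by (simp add: vanishing_preserving_def)
  obtain K where K: "K > 0" "\<And>g. norm (L g) \<le> norm g * K" using L.pos_bounded by blast
  \<comment> \<open>With this value a forcing of norm at most \<open>2 * \<eta> * \<rho>\<close> is
    mapped back into the ball of radius \<open>\<rho>\<close>, and the Lipschitz constant
    \<open>\<eta> * K\<close> of the fixed point map is 1/2.\<close>
  define \<eta> where "\<eta> = 1 / (2 * K)"
  have \<eta>: "\<eta> > 0" using K by (simp add: \<eta>_def)
  show ?thesis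
  proof (intro exI[of _ \<eta>] conjI \<eta> allI impI)
    fix N :: "real \<Rightarrow> real^'n \<Rightarrow> real^'n" and \<rho> :: real
    assume \<rho>: "\<rho> > 0"
      and "\<forall>z. continuous_on UNIV z \<longrightarrow> (\<forall>t. norm (z t) \<le> \<rho>) \<longrightarrow> continuous_on UNIV (\<lambda>t. N t (z t))"
      and "\<forall>t v w. norm v \<le> \<rho> \<longrightarrow> norm w \<le> \<rho> \<longrightarrow> norm (N t v - N t w) \<le> \<eta> * norm (v - w)"
      and "\<forall>t. norm (N t 0) \<le> \<eta> * \<rho>"
      and N0_lim: "((\<lambda>t. N t 0) \<longlongrightarrow> 0) at_top"
    note cont = this(2)[rule_format] and lip = this(3)[rule_format] and N0 = this(4)[rule_format]
    define X where "X = cball 0 \<rho> \<inter> {z :: real \<Rightarrow>\<^sub>C (real^'n). (apply_bcontfun z \<longlongrightarrow> 0) at_top}"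
    define G where "G z = Bcontfun (\<lambda>t. N t (apply_bcontfun z t))" for z
    have zX: "norm (apply_bcontfun z t) \<le> \<rho>" if "z \<in> X" for z t
      using that norm_bounded[of z t] by (simp add: X_def)
    have NX: "norm (N t v) \<le> norm (N t 0) + \<eta> * norm v" if "norm v \<le> \<rho>" for t v
      using lip[OF that, of 0 t] norm_triangle_ineq2[of "N t v" "N t 0"] \<rho> by simp
    have Nb: "norm (N t v) \<le> 2 * \<eta> * \<rho>" if "norm v \<le> \<rho>" for t v
      using NX[OF that, of t] N0[of t] mult_left_mono[OF that less_imp_le[OF \<eta>]] by (simp only: mult.assoc)
    have G: "apply_bcontfun (G z) = (\<lambda>t. N t (z t))" if "z \<in> X" for z
      unfolding G_def
      by (rule Bcontfun_inverse, rule bcontfun_normI[where b="2 * \<eta> * \<rho>"])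
        (auto intro!: cont Nb zX[OF that])
    have "complete X"
      unfolding X_def complete_eq_closed by (intro closed_Int closed_cball closed_vanishing_bcontfun)
    moreover have "X \<noteq> {}"
    proof -
      have "0 \<in> X" using \<rho> by (simp add: X_def zero_bcontfun.rep_eq)
      then show ?thesis by blast
    qed
    moreover have "L (G z) \<in> X" if z: "z \<in> X" for z
    proof -
      have "norm (G z) \<le> 2 * \<eta> * \<rho>"
        by (rule norm_bound) (simp add: G[OF z] Nb zX[OF z])
      then have "norm (L (G z)) \<le> 2 * \<eta> * \<rho> * K"
        using K by (intro order_trans[OF K(2)] mult_right_mono) auto
      then have "norm (L (G z)) \<le> \<rho>" using K by (simp add: \<eta>_def)
      moreover have "(apply_bcontfun (G z) \<longlongrightarrow> 0) at_top"
      proof (rule Lim_null_comparison)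
        have z0: "(apply_bcontfun z \<longlongrightarrow> 0) at_top" using z by (simp add: X_def)
        show "((\<lambda>t. norm (N t 0) + \<eta> * norm (apply_bcontfun z t)) \<longlongrightarrow> 0) at_top"
          using tendsto_add[OF tendsto_norm_zero[OF N0_lim]
              tendsto_mult[OF tendsto_const[of \<eta>] tendsto_norm_zero[OF z0]]] by simp
        show "\<forall>\<^sub>F t in at_top. norm (G z t) \<le> norm (N t 0) + \<eta> * norm (z t)"
          using NX[OF zX[OF z]] by (auto simp: G[OF z])
      qed
      then have "(apply_bcontfun (L (G z)) \<longlongrightarrow> 0) at_top"
        using L by (simp add: vanishing_preserving_def)
      ultimately show ?thesis by (simp add: X_def)
    qed
    moreover have "dist (L (G z)) (L (G w)) \<le> 1 / 2 * dist z w" if z: "z \<in> X" and w: "w \<in> X" for z w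
    proof -
      have "norm (G z - G w) \<le> \<eta> * dist z w"
      proof (rule norm_bound)
        fix t
        have "norm ((G z - G w) t) = norm (N t (z t) - N t (w t))"
          by (simp add: G[OF z] G[OF w])
        also have "\<dots> \<le> \<eta> * norm (z t - w t)" by (rule lip[OF zX[OF z] zX[OF w]])
        also have "\<dots> \<le> \<eta> * dist z w"
          using dist_bounded[of z t w] \<eta> by (simp add: dist_norm)
        finally show "norm ((G z - G w) t) \<le> \<eta> * dist z w" .
      qed
      then have "norm (G z - G w) * K \<le> \<eta> * dist z w * K"
        using K by (intro mult_right_mono) auto
      then show ?thesis
        using K(2)[of "G z - G w"] K(1) by (simp add: dist_norm L.diff \<eta>_def)
    qed
    ultimately have "\<exists>!z. z \<in> X \<and> L (G z) = z"
      by (intro Banach_fix[of X "1/2"]) auto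
    then obtain z where z: "z \<in> X" "L (G z) = z" by blast
    have "(z has_vector_derivative A *v z t + N t (z t)) (at t)" for t
      using dL[of "G z" t] unfolding z(2) G[OF z(1)] .
    then show "\<exists>z. (\<forall>t. norm (z t) \<le> \<rho>) \<and> (z \<longlongrightarrow> 0) at_top \<and>
        (\<forall>t. (z has_vector_derivative A *v z t + N t (z t)) (at t))"
      using z zX[OF z(1)] by (intro exI[of _ "apply_bcontfun z"]) (auto simp: X_def)
  qed
qed

section \<open>The residual term near the horizon\<close>

lemma power_diff_Lipschitz:
  fixes u v R :: real
  assumes "\<bar>u\<bar> \<le> R" "\<bar>v\<bar> \<le> R" "R \<ge> 1"
  shows "\<bar>u ^ n - v ^ n\<bar> \<le> real n * R ^ n * \<bar>u - v\<bar>"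
proof (induction n)
  case (Suc n)
  have "u ^ Suc n - v ^ Suc n = u * (u ^ n - v ^ n) + (u - v) * v ^ n"
    by (simp add: algebra_simps)
  then have "\<bar>u ^ Suc n - v ^ Suc n\<bar> \<le> \<bar>u\<bar> * \<bar>u ^ n - v ^ n\<bar> + \<bar>u - v\<bar> * \<bar>v\<bar> ^ n"
    by (metis abs_mult abs_triangle_ineq power_abs)
  also have "\<dots> \<le> R * (real n * R ^ n * \<bar>u - v\<bar>) + \<bar>u - v\<bar> * (R * R ^ n)"
  proof (rule add_mono)
    show "\<bar>u\<bar> * \<bar>u ^ n - v ^ n\<bar> \<le> R * (real n * R ^ n * \<bar>u - v\<bar>)"
      using assms Suc by (intro mult_mono) auto
    have "\<bar>v\<bar> ^ n \<le> R ^ n" using assms by (intro power_mono) auto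
    also have "\<dots> \<le> R * R ^ n" using assms by simp
    finally show "\<bar>u - v\<bar> * \<bar>v\<bar> ^ n \<le> \<bar>u - v\<bar> * (R * R ^ n)" by (intro mult_left_mono) auto
  qed
  also have "\<dots> = real (Suc n) * R ^ Suc n * \<bar>u - v\<bar>" by (simp add: algebra_simps)
  finally show ?case .
qed simp

text \<open>Quantitative injectivity of the power away from 0. It converts control of b^(2c) into
  control of b when b is defined implicitly.\<close>

lemma power_diff_expansive:
  fixes u v m :: real
  assumes "m > 0" "m \<le> u" "m \<le> v"
  shows "m ^ n * \<bar>u - v\<bar> \<le> \<bar>u ^ Suc n - v ^ Suc n\<bar>"
  using assms(2,3)
proof (induction u v rule: linorder_wlog)
  case (le u v)
  have "m ^ n * (v - u) \<le> v ^ n * (v - u)"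
    using assms(1) le by (intro mult_right_mono power_mono) auto
  also have "\<dots> \<le> v ^ Suc n - u ^ Suc n"
  proof -
    have "u * u ^ n \<le> u * v ^ n"
      using assms(1) le by (intro mult_left_mono power_mono) auto
    then show ?thesis by (simp add: algebra_simps)
  qed
  finally show ?case using le by simp
next
  case (sym u v)
  then show ?case by (simp add: abs_minus_commute)
qed

lemma powr_Lipschitz:
  fixes m M e :: real
  assumes "m > 0"
  obtains C where "C \<ge> 0" "\<And>u v. u \<in> {m..M} \<Longrightarrow> v \<in> {m..M} \<Longrightarrow> \<bar>u powr e - v powr e\<bar> \<le> C * \<bar>u - v\<bar>"
proof -
  \<comment> \<open>The derivative is monotone on the interval, in a direction that depends on
    \<open>e\<close>; the sum of the two endpoint values dominates it in either case.\<close>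
  define C where "C = \<bar>e\<bar> * (m powr (e - 1) + M powr (e - 1))"
  have "\<bar>u powr e - v powr e\<bar> \<le> C * \<bar>u - v\<bar>" if "u \<in> {m..M}" "v \<in> {m..M}" for u v
  proof -
    have "norm (u powr e - v powr e) \<le> C * norm (u - v)"
    proof (rule field_differentiable_bound[where S="{m..M}" and f'="\<lambda>x. e * x powr (e - 1)"])
      fix x assume x: "x \<in> {m..M}"
      then have "x > 0" using assms by auto
      then show "((\<lambda>x. x powr e) has_field_derivative e * x powr (e - 1)) (at x within {m..M})"
        by (rule has_field_derivative_at_within[OF has_real_derivative_powr])
      have "x powr (e - 1) \<le> m powr (e - 1) + M powr (e - 1)"
      proof (cases "e \<ge> 1")
        case True
        then have "x powr (e - 1) \<le> M powr (e - 1)"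
          using x assms by (intro powr_mono2) auto
        then show ?thesis by (simp add: add_increasing)
      next
        case False
        then have "x powr (e - 1) \<le> m powr (e - 1)"
          using x assms by (intro powr_mono2') auto
        then show ?thesis by (simp add: add_increasing2)
      qed
      then show "norm (e * x powr (e - 1)) \<le> C"
        by (simp add: C_def abs_mult mult_left_mono)
    qed (use that in auto)
    then show ?thesis by simp
  qed
  then show ?thesis by (intro that[of C]) (auto simp: C_def)
qed

text \<open>This is p^(2c) freed of the root: a polynomial, hence differentiable also at 0, and
  convex because all exponents are even. \<open>kappa\<close> involves p only through this
  power.\<close>

definition qpoly :: "('n::finite \<Rightarrow> nat) \<Rightarrow> real^'n \<Rightarrow> real" where
  "qpoly \<alpha> x = (\<Sum>i\<in>UNIV. (x $ i) ^ (2 * beta \<alpha> i))"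

lemma qpoly_nonneg: "qpoly \<alpha> x \<ge> 0"
  unfolding qpoly_def by (intro sum_nonneg) (simp add: power_mult)

lemma lcm_type_pos:
  fixes \<alpha> :: "'n::finite \<Rightarrow> nat"
  assumes "\<And>i. \<alpha> i > 0"
  shows "lcm_type \<alpha> > 0"
  using assms by (auto simp: lcm_type_def Lcm_0_iff intro!: gr0I) (metis less_irrefl)

lemma type_times_beta: "\<alpha> i * beta \<alpha> i = lcm_type (\<alpha> :: 'n::finite \<Rightarrow> nat)"
  by (simp add: beta_def lcm_type_def)

lemma qpoly_pos:
  fixes \<alpha> :: "'n::finite \<Rightarrow> nat"
  assumes "\<And>i. \<alpha> i > 0" "x \<noteq> 0"
  shows "qpoly \<alpha> x > 0"
proof -
  obtain i where i: "x $ i \<noteq> 0" using assms(2) by (auto simp: vec_eq_iff)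
  have "0 < (x $ i) ^ (2 * beta \<alpha> i)" using i by (simp add: power_mult zero_less_power)
  also have "\<dots> \<le> qpoly \<alpha> x"
    unfolding qpoly_def by (rule member_le_sum) (auto simp: power_mult)
  finally show ?thesis .
qed

lemma pfun_power:
  fixes \<alpha> :: "'n::finite \<Rightarrow> nat"
  assumes "\<And>i. \<alpha> i > 0"
  shows "pfun \<alpha> x ^ (2 * lcm_type \<alpha>) = qpoly \<alpha> x" and "pfun \<alpha> x \<ge> 0"
  using lcm_type_pos[of \<alpha>, OF assms] qpoly_nonneg[of \<alpha> x]
  unfolding pfun_def qpoly_def[symmetric]
  by (auto intro!: real_root_pow_pos2)

lemma kappa_qpoly:
  fixes \<alpha> :: "'n::finite \<Rightarrow> nat"
  assumes "\<And>i. \<alpha> i > 0"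
  shows "kappa \<alpha> x = 1 / (1 - qpoly \<alpha> x)"
  by (simp add: kappa_def pfun_power(1)[OF assms])

lemma qpoly_qscale: "qpoly \<alpha> (qscale \<alpha> s x) = s ^ (2 * lcm_type \<alpha>) * qpoly \<alpha> x"
proof -
  have eq: "\<alpha> i * (2 * beta \<alpha> i) = 2 * lcm_type \<alpha>" for i
    using type_times_beta[of \<alpha> i] by simp
  show ?thesis
    unfolding qpoly_def qscale_def
    by (simp add: power_mult_distrib sum_distrib_left flip: power_mult) (simp only: eq)
qed

text \<open>Even powers are convex. Segments between points of the open domain therefore stay where
  \<open>tilde_in\<close> is differentiable, so a mean value estimate cannot run into the
  horizon.\<close>

lemma qpoly_convex:
  assumes "qpoly \<alpha> x < 1" "qpoly \<alpha> y < 1" "z \<in> closed_segment x y"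
  shows "qpoly \<alpha> z < 1"
proof -
  obtain t where t: "0 \<le> t" "t \<le> 1" "z = (1 - t) *\<^sub>R x + t *\<^sub>R y"
    using assms(3) by (auto simp: in_segment)
  have "qpoly \<alpha> z \<le> (1 - t) * qpoly \<alpha> x + t * qpoly \<alpha> y"
    unfolding qpoly_def sum_distrib_left sum.distrib[symmetric]
  proof (rule sum_mono)
    fix i
    show "(z $ i) ^ (2 * beta \<alpha> i) \<le> (1 - t) * (x $ i) ^ (2 * beta \<alpha> i) + t * (y $ i) ^ (2 * beta \<alpha> i)"
      using convex_onD[OF convex_power_even[of "2 * beta \<alpha> i"], of t "x $ i" "y $ i"] t by simp
  qed
  also have "\<dots> < 1" using assms(1,2) t
    by (rule_tac convex_bound_lt) auto
  finally show ?thesis .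
qed

lemma qpoly_Lipschitz:
  fixes \<alpha> :: "'n::finite \<Rightarrow> nat"
  obtains C where "C \<ge> 0"
    "\<And>x y. norm x \<le> R \<Longrightarrow> norm y \<le> R \<Longrightarrow> \<bar>qpoly \<alpha> x - qpoly \<alpha> y\<bar> \<le> C * norm (x - y)"
proof -
  define R' where "R' = max R 1"
  define C where "C = (\<Sum>i\<in>UNIV. real (2 * beta \<alpha> i) * R' ^ (2 * beta \<alpha> i))"
  have "\<bar>qpoly \<alpha> x - qpoly \<alpha> y\<bar> \<le> C * norm (x - y)" if "norm x \<le> R" "norm y \<le> R" for x y :: "real^'n"
  proof -
    have "\<bar>qpoly \<alpha> x - qpoly \<alpha> y\<bar> \<le> (\<Sum>i\<in>UNIV. \<bar>(x $ i) ^ (2 * beta \<alpha> i) - (y $ i) ^ (2 * beta \<alpha> i)\<bar>)"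
      unfolding qpoly_def sum_subtractf[symmetric] by (rule sum_abs)
    also have "\<dots> \<le> (\<Sum>i\<in>UNIV. real (2 * beta \<alpha> i) * R' ^ (2 * beta \<alpha> i) * norm (x - y))"
    proof (rule sum_mono)
      fix i
      have "\<bar>x $ i\<bar> \<le> R'" "\<bar>y $ i\<bar> \<le> R'"
        using that component_le_norm_cart[of x i] component_le_norm_cart[of y i] by (auto simp: R'_def)
      then have "\<bar>(x $ i) ^ (2 * beta \<alpha> i) - (y $ i) ^ (2 * beta \<alpha> i)\<bar>
          \<le> real (2 * beta \<alpha> i) * R' ^ (2 * beta \<alpha> i) * \<bar>x $ i - y $ i\<bar>"
        by (rule power_diff_Lipschitz) (simp add: R'_def)
      also have "\<dots> \<le> real (2 * beta \<alpha> i) * R' ^ (2 * beta \<alpha> i) * norm (x - y)"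
        using component_le_norm_cart[of "x - y" i] by (intro mult_left_mono) (auto simp: R'_def)
      finally show "\<bar>(x $ i) ^ (2 * beta \<alpha> i) - (y $ i) ^ (2 * beta \<alpha> i)\<bar>
          \<le> real (2 * beta \<alpha> i) * R' ^ (2 * beta \<alpha> i) * norm (x - y)" .
    qed
    also have "\<dots> = C * norm (x - y)" by (simp add: C_def sum_distrib_right)
    finally show ?thesis .
  qed
  moreover have "C \<ge> 0" by (auto simp: C_def R'_def intro!: sum_nonneg)
  ultimately show ?thesis using that by blast
qed

lemma qscale_Lipschitz:
  fixes \<alpha> :: "'n::finite \<Rightarrow> nat"
  obtains C where "C \<ge> 0"
    "\<And>b b' x y. \<bar>b\<bar> \<le> R \<Longrightarrow> \<bar>b'\<bar> \<le> R \<Longrightarrow> norm x \<le> R \<Longrightarrow> norm y \<le> R \<Longrightarrow>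
       norm (qscale \<alpha> b x - qscale \<alpha> b' y) \<le> C * (\<bar>b - b'\<bar> + norm (x - y))"
proof -
  define R' where "R' = max R 1"
  define D where "D i = real (\<alpha> i) * R' ^ \<alpha> i * R' + R' ^ \<alpha> i" for i
  define C where "C = (\<Sum>i\<in>UNIV. D i)"
  have R': "R' \<ge> 1" "R \<le> R'" by (auto simp: R'_def)
  have "norm (qscale \<alpha> b x - qscale \<alpha> b' y) \<le> C * (\<bar>b - b'\<bar> + norm (x - y))"
    if b: "\<bar>b\<bar> \<le> R" "\<bar>b'\<bar> \<le> R" and x: "norm x \<le> R" "norm y \<le> R" for b b' and x y :: "real^'n"
  proof -
    have "norm (qscale \<alpha> b x - qscale \<alpha> b' y) \<le> (\<Sum>i\<in>UNIV. \<bar>(qscale \<alpha> b x - qscale \<alpha> b' y) $ i\<bar>)"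
      by (rule norm_le_l1_cart)
    also have "\<dots> \<le> (\<Sum>i\<in>UNIV. D i * (\<bar>b - b'\<bar> + norm (x - y)))"
    proof (rule sum_mono)
      fix i
      have "(qscale \<alpha> b x - qscale \<alpha> b' y) $ i = (b ^ \<alpha> i - b' ^ \<alpha> i) * x $ i + b' ^ \<alpha> i * (x $ i - y $ i)"
        by (simp add: qscale_def algebra_simps)
      then have "\<bar>(qscale \<alpha> b x - qscale \<alpha> b' y) $ i\<bar> \<le> \<bar>b ^ \<alpha> i - b' ^ \<alpha> i\<bar> * \<bar>x $ i\<bar> + \<bar>b'\<bar> ^ \<alpha> i * \<bar>x $ i - y $ i\<bar>"
        by (metis abs_mult abs_triangle_ineq power_abs)
      also have "\<dots> \<le> (real (\<alpha> i) * R' ^ \<alpha> i * \<bar>b - b'\<bar>) * R' + R' ^ \<alpha> i * norm (x - y)"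
      proof (intro add_mono mult_mono)
        show "\<bar>b ^ \<alpha> i - b' ^ \<alpha> i\<bar> \<le> real (\<alpha> i) * R' ^ \<alpha> i * \<bar>b - b'\<bar>"
          by (rule power_diff_Lipschitz) (use b R' in auto)
        show "\<bar>x $ i\<bar> \<le> R'" using component_le_norm_cart[of x i] x R' by linarith
        show "\<bar>b'\<bar> ^ \<alpha> i \<le> R' ^ \<alpha> i" using b R' by (intro power_mono) auto
        show "\<bar>x $ i - y $ i\<bar> \<le> norm (x - y)" using component_le_norm_cart[of "x - y" i] by simp
      qed (use R' in auto)
      also have "\<dots> \<le> D i * (\<bar>b - b'\<bar> + norm (x - y))"
      proof -
        have "0 \<le> real (\<alpha> i) * R' ^ \<alpha> i * R' * norm (x - y) + R' ^ \<alpha> i * \<bar>b - b'\<bar>"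
          using R' by auto
        then show ?thesis by (simp add: D_def algebra_simps)
      qed
      finally show "\<bar>(qscale \<alpha> b x - qscale \<alpha> b' y) $ i\<bar> \<le> D i * (\<bar>b - b'\<bar> + norm (x - y))" .
    qed
    also have "\<dots> = C * (\<bar>b - b'\<bar> + norm (x - y))" by (simp add: C_def sum_distrib_right)
    finally show ?thesis .
  qed
  moreover have "C \<ge> 0" unfolding C_def D_def using R' by (intro sum_nonneg) auto
  ultimately show ?thesis using that by blast
qed

text \<open>With \<open>\<tau> = 1 / \<sigma>\<close>, the solution \<open>b\<close> gives the point \<open>x = b\<^sup>\<Lambda> Y\<close> with
  \<open>\<kappa>(x) = \<sigma> / b\<close>, so that \<open>\<sigma>\<^sup>\<Lambda> Y = \<kappa>(x)\<^sup>\<Lambda> x\<close>.\<close>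
lemma compactified_scale:
  fixes \<alpha> :: "'n::finite \<Rightarrow> nat"
  assumes \<alpha>: "\<And>i. \<alpha> i > 0" and Y0: "Y0 \<noteq> 0"
  obtains B :: "real \<Rightarrow> real^'n \<Rightarrow> real" and m M C \<rho> \<tau>1 :: real
  where "0 < m" "0 \<le> C" "0 < \<rho>" "0 < \<tau>1"
    and "\<And>\<tau> Y. 0 < \<tau> \<Longrightarrow> \<tau> \<le> \<tau>1 \<Longrightarrow> Y \<in> cball Y0 \<rho> \<Longrightarrow>
          B \<tau> Y \<in> {m..M} \<and> B \<tau> Y ^ (2 * lcm_type \<alpha>) * qpoly \<alpha> Y + B \<tau> Y * \<tau> = 1"
    and "\<And>\<tau> Y Y'. 0 < \<tau> \<Longrightarrow> \<tau> \<le> \<tau>1 \<Longrightarrow> Y \<in> cball Y0 \<rho> \<Longrightarrow> Y' \<in> cball Y0 \<rho> \<Longrightarrow>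
          \<bar>B \<tau> Y - B \<tau> Y'\<bar> \<le> C * norm (Y - Y')"
proof -
  define n where "n = 2 * lcm_type \<alpha> - 1"
  have n: "2 * lcm_type \<alpha> = Suc n" and n1: "n \<ge> 1"
    using lcm_type_pos[of \<alpha>, OF \<alpha>] by (auto simp: n_def)
  define P0 where "P0 = qpoly \<alpha> Y0"
  have P0: "P0 > 0" unfolding P0_def by (rule qpoly_pos[OF \<alpha> Y0])
  \<comment> \<open>The solution for \<open>Y = Y0\<close> in the limit \<tau> = 0. It equals
    1/p(Y0), so \<open>qscale \<alpha> b0 Y0\<close> is the point of the horizon that corresponds to
    Y0.\<close>
  define b0 where "b0 = root (Suc n) (1 / P0)"
  have b0: "b0 > 0" "b0 ^ Suc n = 1 / P0"
    using P0 real_root_pow_pos2[of "Suc n" "1 / P0"] by (auto simp: b0_def simp del: power_Suc)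
  \<comment> \<open>A bracket for the intermediate value theorem. The left side of the equation is
    at most 3/8 + 1/2 at \<open>m\<close> and at least 1 at \<open>M\<close>; the radius
    \<open>\<rho>\<close> keeps \<open>qpoly\<close> within P0/2 of \<open>P0\<close>, and
    \<open>\<tau>1\<close> gives the 1/2.\<close>
  define m M where "m = b0 / 2" and "M = 2 * b0"
  have mM: "0 < m" "m \<le> M" using b0 by (auto simp: m_def M_def)
  define R where "R = norm Y0 + 1"
  obtain Cq where Cq: "Cq \<ge> 0"
    "\<And>x y. norm x \<le> R \<Longrightarrow> norm y \<le> R \<Longrightarrow> \<bar>qpoly \<alpha> x - qpoly \<alpha> y\<bar> \<le> Cq * norm (x - y)"
    by (rule qpoly_Lipschitz[of R \<alpha>]) blast
  define \<rho> where "\<rho> = min 1 (P0 / (2 * (Cq + 1)))"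
  define \<tau>1 where "\<tau>1 = 1 / b0"
  have \<rho>: "\<rho> > 0" "\<rho> \<le> 1" and \<tau>1: "\<tau>1 > 0" using P0 Cq b0 by (auto simp: \<rho>_def \<tau>1_def)
  have YR: "norm Y \<le> R" if "Y \<in> cball Y0 \<rho>" for Y
    using that \<rho> norm_triangle_ineq2[of Y Y0] by (auto simp: R_def dist_norm norm_minus_commute)
  have PY: "P0 / 2 \<le> qpoly \<alpha> Y" "qpoly \<alpha> Y \<le> 3 / 2 * P0" if "Y \<in> cball Y0 \<rho>" for Y
  proof -
    have "Cq * norm (Y - Y0) \<le> (Cq + 1) * \<rho>"
      using that Cq by (intro mult_mono) (auto simp: dist_norm norm_minus_commute)
    also have "\<dots> \<le> (Cq + 1) * (P0 / (2 * (Cq + 1)))"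
      using Cq by (intro mult_left_mono) (auto simp: \<rho>_def)
    also have "\<dots> = P0 / 2" using Cq by (simp add: field_simps)
    finally have "\<bar>qpoly \<alpha> Y - P0\<bar> \<le> P0 / 2"
      using Cq(2)[OF YR[OF that] YR[of Y0]] \<rho> by (simp add: P0_def)
    then show "P0 / 2 \<le> qpoly \<alpha> Y" "qpoly \<alpha> Y \<le> 3 / 2 * P0" by linarith+
  qed
  have ex: "\<exists>b\<in>{m..M}. b ^ Suc n * qpoly \<alpha> Y + b * \<tau> = 1"
    if \<tau>: "0 < \<tau>" "\<tau> \<le> \<tau>1" and Y: "Y \<in> cball Y0 \<rho>" for \<tau> Y
  proof -
    have p2: "(2::real) ^ Suc n \<ge> 4"
      using power_increasing[of 2 "Suc n" "2::real"] n1 by simp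
    have "m ^ Suc n * qpoly \<alpha> Y \<le> m ^ Suc n * (3 / 2 * P0)"
      using PY[OF Y] mM by (intro mult_left_mono) auto
    also have "\<dots> = 3 / 2 / 2 ^ Suc n"
      using b0(2) P0 by (simp add: m_def power_divide del: power_Suc)
    also have "\<dots> \<le> 3 / 2 / 4"
      using p2 by (intro divide_left_mono) auto
    finally have 1: "m ^ Suc n * qpoly \<alpha> Y \<le> 3 / 8" by simp
    have "b0 * \<tau> \<le> b0 * \<tau>1" using b0 \<tau> by (intro mult_left_mono) auto
    then have 2: "m * \<tau> \<le> 1 / 2" using b0 by (simp add: m_def \<tau>1_def)
    have "1 \<le> 4 * (P0 / 2) * b0 ^ Suc n" using b0(2) P0 by simp
    also have "\<dots> \<le> 2 ^ Suc n * qpoly \<alpha> Y * b0 ^ Suc n"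
      using p2 PY[OF Y] b0(1) P0 by (intro mult_right_mono mult_mono) auto
    also have "\<dots> = M ^ Suc n * qpoly \<alpha> Y"
      by (simp add: M_def power_mult_distrib)
    finally have 3: "1 \<le> M ^ Suc n * qpoly \<alpha> Y" .
    have 4: "0 \<le> M * \<tau>" using mM \<tau> by simp
    have "\<exists>b\<ge>m. b \<le> M \<and> b ^ Suc n * qpoly \<alpha> Y + b * \<tau> = 1"
      using 1 2 3 4 mM by (intro IVT') (auto intro!: continuous_intros)
    then show ?thesis by auto
  qed
  define B where "B \<tau> Y = (SOME b. b \<in> {m..M} \<and> b ^ Suc n * qpoly \<alpha> Y + b * \<tau> = 1)" for \<tau> Y
  have B: "B \<tau> Y \<in> {m..M} \<and> B \<tau> Y ^ Suc n * qpoly \<alpha> Y + B \<tau> Y * \<tau> = 1"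
    if "0 < \<tau>" "\<tau> \<le> \<tau>1" "Y \<in> cball Y0 \<rho>" for \<tau> Y
    unfolding B_def using ex[OF that] by (rule_tac someI_ex) blast
  define C where "C = M ^ Suc n * Cq / (m ^ n * (P0 / 2))"
  have C: "C \<ge> 0" unfolding C_def using mM Cq P0 by auto
  have lip: "\<bar>B \<tau> Y - B \<tau> Y'\<bar> \<le> C * norm (Y - Y')"
    if \<tau>: "0 < \<tau>" "\<tau> \<le> \<tau>1" and Y: "Y \<in> cball Y0 \<rho>" and Y': "Y' \<in> cball Y0 \<rho>" for \<tau> Y Y'
  proof -
    define b b' where "b = B \<tau> Y" and "b' = B \<tau> Y'"
    have b: "m \<le> b" "b \<le> M" "b ^ Suc n * qpoly \<alpha> Y + b * \<tau> = 1"
      and b': "m \<le> b'" "b' \<le> M" "b' ^ Suc n * qpoly \<alpha> Y' + b' * \<tau> = 1"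
      using B[OF \<tau> Y] B[OF \<tau> Y'] by (auto simp: b_def b'_def)
    \<comment> \<open>The difference of the two defining equations. Both terms on its left have the
      sign of \<open>b - b'\<close>, since the power is increasing on positive numbers. The \<tau>
      term can therefore be dropped from the lower bound, which makes the Lipschitz constant
      independent of \<tau>.\<close>
    have eq: "(b ^ Suc n - b' ^ Suc n) * qpoly \<alpha> Y + (b - b') * \<tau> = b' ^ Suc n * (qpoly \<alpha> Y' - qpoly \<alpha> Y)"
      using b(3) b'(3) by (simp only: left_diff_distrib right_diff_distrib)
    have same: "\<bar>(b ^ Suc n - b' ^ Suc n) * qpoly \<alpha> Y + (b - b') * \<tau>\<bar> \<ge> \<bar>b ^ Suc n - b' ^ Suc n\<bar> * qpoly \<alpha> Y"
    proof (cases "b \<ge> b'")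
      case True
      then have "b ^ Suc n \<ge> b' ^ Suc n" using b' mM by (intro power_mono) auto
      moreover have "(b - b') * \<tau> \<ge> 0" using True \<tau> by simp
      ultimately show ?thesis using qpoly_nonneg[of \<alpha> Y] by (simp del: power_Suc)
    next
      case False
      then have le: "b ^ Suc n \<le> b' ^ Suc n" using b mM by (intro power_mono) auto
      have "(b - b') * \<tau> \<le> 0" using False \<tau> by (intro mult_nonpos_nonneg) auto
      moreover have "(b ^ Suc n - b' ^ Suc n) * qpoly \<alpha> Y \<le> 0"
        using le qpoly_nonneg[of \<alpha> Y] by (intro mult_nonpos_nonneg) auto
      moreover have "\<bar>b ^ Suc n - b' ^ Suc n\<bar> * qpoly \<alpha> Y = - ((b ^ Suc n - b' ^ Suc n) * qpoly \<alpha> Y)"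
        using le by (simp del: power_Suc add: left_diff_distrib)
      ultimately show ?thesis by linarith
    qed
    have "m ^ n * \<bar>b - b'\<bar> * (P0 / 2) \<le> \<bar>b ^ Suc n - b' ^ Suc n\<bar> * qpoly \<alpha> Y"
      using power_diff_expansive[OF mM(1) b(1) b'(1)] PY[OF Y] P0 by (intro mult_mono) auto
    also have "\<dots> \<le> \<bar>b' ^ Suc n * (qpoly \<alpha> Y' - qpoly \<alpha> Y)\<bar>"
      using same eq by simp
    also have "\<dots> = b' ^ Suc n * \<bar>qpoly \<alpha> Y - qpoly \<alpha> Y'\<bar>"
      using b' mM by (simp add: abs_mult abs_minus_commute del: power_Suc)
    also have "\<dots> \<le> M ^ Suc n * (Cq * norm (Y - Y'))"
      using b' mM Cq(2)[OF YR[OF Y] YR[OF Y']] by (intro mult_mono power_mono) auto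
    finally show ?thesis
      unfolding b_def[symmetric] b'_def[symmetric] using mM P0
      by (simp add: C_def field_simps)
  qed
  show ?thesis
    by (rule that[OF mM(1) C \<rho>(1) \<tau>1 B[folded n] lip])
qed

lemma differentiable_vec_nth: "(\<lambda>x. x $ i) differentiable F"
  by (intro bounded_linear_imp_differentiable bounded_linear_vec_nth)

lemma qpoly_differentiable: "qpoly \<alpha> differentiable (at x)"
  unfolding qpoly_def[abs_def]
  by (rule differentiable_sum) (auto intro!: differentiable_power differentiable_vec_nth)

text \<open>\<open>frechet_derivative\<close> is a choice operator; differentiability turns its
  values into true derivatives, so that bounds on them can enter a mean value estimate.\<close>

lemma tilde_in_differentiable:
  fixes \<alpha> :: "'n::finite \<Rightarrow> nat"
  assumes \<alpha>: "\<And>i. \<alpha> i > 0" and h: "\<And>y. h differentiable (at y)" and x: "qpoly \<alpha> x < 1"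
  shows "(\<lambda>z. tilde_in \<alpha> k h z $ i) differentiable (at x)"
proof -
  have kap: "kappa \<alpha> differentiable (at x)"
    unfolding kappa_qpoly[where \<alpha>=\<alpha>, OF \<alpha>, abs_def] using x
    by (intro differentiable_divide differentiable_diff qpoly_differentiable) auto
  have "kappa \<alpha> x > 0" using x by (simp add: kappa_qpoly[where \<alpha>=\<alpha>, OF \<alpha>])
  then have "(\<lambda>u. u powr (- (k + real (\<alpha> i)))) differentiable (at (kappa \<alpha> x))"
    using has_real_derivative_powr real_differentiable_def by blast
  from differentiable_chain_at[OF kap this]
  have 1: "(\<lambda>z. kappa \<alpha> z powr (- (k + real (\<alpha> i)))) differentiable (at x)" by (simp add: o_def)
  have "(\<lambda>z. qscale \<alpha> (kappa \<alpha> z) z) differentiable (at x)"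
    by (rule differentiable_componentwise_within[THEN iffD2])
      (auto simp: Basis_vec_def inner_axis qscale_def
        intro!: differentiable_mult differentiable_power kap differentiable_vec_nth)
  from differentiable_chain_at[OF differentiable_chain_at[OF this h] differentiable_vec_nth]
  have 2: "(\<lambda>z. h (qscale \<alpha> (kappa \<alpha> z) z) $ i) differentiable (at x)" by (simp add: o_def)
  show ?thesis
    unfolding tilde_in_def vec_lambda_beta by (rule differentiable_mult[OF 1 2])
qed

lemma onorm_le_partial_derivatives:
  fixes D :: "real^'n::finite \<Rightarrow> real"
  assumes D: "linear D" and le: "\<And>l. \<bar>D (axis l 1)\<bar> \<le> \<eta>"
  shows "onorm D \<le> real CARD('n) * \<eta>"
proof -
  have \<eta>: "\<eta> \<ge> 0" using le[of undefined] by linarith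
  show ?thesis
  proof (rule onorm_bound)
    fix v :: "real^'n"
    have "D v = D (\<Sum>l\<in>UNIV. v $ l *\<^sub>R axis l 1)"
      using basis_expansion[of v] by (simp add: scalar_mult_eq_scaleR)
    also have "\<dots> = (\<Sum>l\<in>UNIV. v $ l * D (axis l 1))"
      by (simp add: linear_sum[OF D] linear_scale[OF D])
    finally have "norm (D v) \<le> (\<Sum>l\<in>UNIV. \<bar>v $ l * D (axis l 1)\<bar>)" by simp
    also have "\<dots> \<le> (\<Sum>l\<in>(UNIV::'n set). norm v * \<eta>)"
      unfolding abs_mult by (intro sum_mono mult_mono component_le_norm_cart le) auto
    finally show "norm (D v) \<le> real CARD('n) * \<eta> * norm v" by (simp add: algebra_simps)
  qed (use \<eta> in auto)
qed

lemma eventually_to_horizonD: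
  fixes \<alpha> :: "'n::finite \<Rightarrow> nat"
  assumes \<alpha>: "\<And>i. \<alpha> i > 0" and "eventually Q (to_horizon \<alpha>)"
  obtains \<delta> where "\<delta> > 0" "\<And>x. 1 - \<delta> < qpoly \<alpha> x \<Longrightarrow> qpoly \<alpha> x < 1 \<Longrightarrow> Q x"
proof -
  obtain Q' where Q': "eventually Q' (at_left (1::real))" "\<And>x. Q' (pfun \<alpha> x) \<Longrightarrow> Q x"
    using assms(2) unfolding to_horizon_def eventually_filtercomap by blast
  obtain b where b: "b < 1" "\<And>y. b < y \<Longrightarrow> y < 1 \<Longrightarrow> Q' y"
    using Q'(1) eventually_at_left[of 0 "1::real"] by auto
  \<comment> \<open>The threshold \<open>b\<close> may be negative, and raising to the even power
    \<open>N\<close> is monotone only on nonnegative numbers.\<close>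
  define b' where "b' = max b 0"
  have b': "0 \<le> b'" "b' < 1" "b \<le> b'" using b by (auto simp: b'_def)
  define N where "N = 2 * lcm_type \<alpha>"
  have N: "N > 0" using lcm_type_pos[of \<alpha>, OF \<alpha>] by (simp add: N_def)
  show ?thesis
  proof (rule that[of "1 - b' ^ N"])
    show "1 - b' ^ N > 0" using b' N by (simp add: power_less_one_iff)
    fix x assume x: "1 - (1 - b' ^ N) < qpoly \<alpha> x" "qpoly \<alpha> x < 1"
    have pf: "pfun \<alpha> x ^ N = qpoly \<alpha> x" "pfun \<alpha> x \<ge> 0"
      using pfun_power[where \<alpha>=\<alpha>, OF \<alpha>] by (auto simp: N_def)
    have "b' < pfun \<alpha> x"
      using x pf power_less_imp_less_base[of b' N "pfun \<alpha> x"] by simp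
    moreover have "pfun \<alpha> x < 1"
      using x pf power_less_imp_less_base[of "pfun \<alpha> x" N 1] by simp
    ultimately show "Q x" using b' by (intro Q'(2) b(2)) auto
  qed
qed

text \<open>In the open domain \<open>kappa\<close> is at least 1, and 1/\<kappa> is exactly
  \<open>1 - qpoly \<alpha> x\<close>. The decay rate thus becomes the distance to the horizon,
  which for the points used later equals b/\<sigma>.\<close>

lemma kappa_powr_le:
  fixes \<alpha> :: "'n::finite \<Rightarrow> nat"
  assumes \<alpha>: "\<And>i. \<alpha> i > 0" and "qpoly \<alpha> x < 1" "\<epsilon> \<ge> 0"
  shows "kappa \<alpha> x powr (- (1 + \<epsilon>)) \<le> 1 - qpoly \<alpha> x"
proof -
  have "kappa \<alpha> x \<ge> 1"
    using assms(2) qpoly_nonneg[of \<alpha> x] by (simp add: kappa_qpoly[where \<alpha>=\<alpha>, OF \<alpha>])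
  then have "kappa \<alpha> x powr (- (1 + \<epsilon>)) \<le> kappa \<alpha> x powr (- 1)"
    using assms(3) by (intro powr_mono) auto
  also have "\<dots> = 1 - qpoly \<alpha> x"
    using assms(2) by (simp add: kappa_qpoly[where \<alpha>=\<alpha>, OF \<alpha>] powr_minus)
  finally show ?thesis .
qed

text \<open>The little-o bound makes all partial derivatives small in a thin layer below the
  horizon. The layer is not convex, so the segment is required to lie in it; this has to be checked
  at each use.\<close>

lemma tilde_in_Lipschitz:
  fixes \<alpha> :: "'n::finite \<Rightarrow> nat"
  assumes \<alpha>: "\<And>i. \<alpha> i > 0" and h: "\<And>y. h differentiable (at y)"
    and "\<epsilon> \<ge> 0" "\<eta> > 0"
    and o: "\<And>l. (\<lambda>x. frechet_derivative (\<lambda>z. tilde_in \<alpha> k h z $ i) (at x) (axis l 1))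
               \<in> o[to_horizon \<alpha>](\<lambda>x. kappa \<alpha> x powr (- (1 + \<epsilon>)))"
  obtains \<delta> where "\<delta> > 0"
    and "\<And>x y. (\<And>z. z \<in> closed_segment x y \<Longrightarrow> 1 - \<delta> < qpoly \<alpha> z \<and> qpoly \<alpha> z < 1) \<Longrightarrow>
      \<bar>tilde_in \<alpha> k h x $ i - tilde_in \<alpha> k h y $ i\<bar> \<le> \<eta> * norm (x - y)"
proof -
  define g where "g z = tilde_in \<alpha> k h z $ i" for z
  define D where "D x = frechet_derivative g (at x)" for x
  define \<eta>' where "\<eta>' = \<eta> / real CARD('n)"
  have \<eta>': "\<eta>' > 0" using \<open>\<eta> > 0\<close> by (simp add: \<eta>'_def)
  have "\<forall>\<^sub>F x in to_horizon \<alpha>. \<forall>l. norm (D x (axis l 1)) \<le> \<eta>' * norm (kappa \<alpha> x powr (- (1 + \<epsilon>)))"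
    using landau_o.smallD[OF o \<eta>'] unfolding g_def[symmetric] D_def[symmetric]
    by (intro eventually_all_finite) auto
  from eventually_to_horizonD[where \<alpha>=\<alpha>, OF \<alpha> this]
  obtain \<delta> where \<delta>: "\<delta> > 0" "\<And>x l. 1 - \<delta> < qpoly \<alpha> x \<Longrightarrow> qpoly \<alpha> x < 1 \<Longrightarrow>
      norm (D x (axis l 1)) \<le> \<eta>' * norm (kappa \<alpha> x powr (- (1 + \<epsilon>)))" by metis
  have "\<bar>g x - g y\<bar> \<le> \<eta> * norm (x - y)"
    if seg: "\<And>z. z \<in> closed_segment x y \<Longrightarrow> 1 - \<delta> < qpoly \<alpha> z \<and> qpoly \<alpha> z < 1" for x y
  proof -
    have "norm (g x - g y) \<le> \<eta> * norm (x - y)"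
    proof (rule differentiable_bound[of "closed_segment x y" g D])
      fix z assume z: "z \<in> closed_segment x y"
      have der: "(g has_derivative D z) (at z)"
        unfolding D_def frechet_derivative_works[symmetric] g_def[abs_def]
        using tilde_in_differentiable[where \<alpha>=\<alpha>, OF \<alpha> h] seg[OF z] by blast
      then show "(g has_derivative D z) (at z within closed_segment x y)"
        by (rule has_derivative_at_withinI)
      have "\<bar>D z (axis l 1)\<bar> \<le> \<eta>'" for l
      proof -
        have "\<bar>D z (axis l 1)\<bar> \<le> \<eta>' * (kappa \<alpha> z powr (- (1 + \<epsilon>)))"
          using \<delta>(2)[of z l] seg[OF z] by simp
        also have "\<dots> \<le> \<eta>' * 1"
          using kappa_powr_le[where \<alpha>=\<alpha>, OF \<alpha>, of z \<epsilon>] seg[OF z] \<open>\<epsilon> \<ge> 0\<close> qpoly_nonneg[of \<alpha> z] \<eta>'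
          by (intro mult_left_mono) auto
        finally show ?thesis by simp
      qed
      from onorm_le_partial_derivatives[OF has_derivative_linear[OF der] this]
      show "onorm (D z) \<le> \<eta>" by (simp add: \<eta>'_def)
    qed auto
    then show ?thesis by simp
  qed
  then show ?thesis using that[OF \<delta>(1)] unfolding g_def by blast
qed

lemma tilde_in_bound:
  fixes \<alpha> :: "'n::finite \<Rightarrow> nat"
  assumes \<alpha>: "\<And>i. \<alpha> i > 0" and "\<epsilon> \<ge> 0"
    and O: "(\<lambda>x. tilde_in \<alpha> k h x $ i) \<in> O[to_horizon \<alpha>](\<lambda>x. kappa \<alpha> x powr (- (1 + \<epsilon>)))"
  obtains C \<delta> where "C \<ge> 0" "\<delta> > 0"
    and "\<And>x. 1 - \<delta> < qpoly \<alpha> x \<Longrightarrow> qpoly \<alpha> x < 1 \<Longrightarrow> \<bar>tilde_in \<alpha> k h x $ i\<bar> \<le> C * (1 - qpoly \<alpha> x)"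
proof -
  obtain C where C: "C > 0" "\<forall>\<^sub>F x in to_horizon \<alpha>. norm (tilde_in \<alpha> k h x $ i) \<le> C * norm (kappa \<alpha> x powr (- (1 + \<epsilon>)))"
    using landau_o.bigE[OF O] by blast
  from eventually_to_horizonD[where \<alpha>=\<alpha>, OF \<alpha> C(2)]
  obtain \<delta> where \<delta>: "\<delta> > 0" "\<And>x. 1 - \<delta> < qpoly \<alpha> x \<Longrightarrow> qpoly \<alpha> x < 1 \<Longrightarrow>
      norm (tilde_in \<alpha> k h x $ i) \<le> C * norm (kappa \<alpha> x powr (- (1 + \<epsilon>)))" by metis
  have "\<bar>tilde_in \<alpha> k h x $ i\<bar> \<le> C * (1 - qpoly \<alpha> x)" if "1 - \<delta> < qpoly \<alpha> x" "qpoly \<alpha> x < 1" for x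
  proof -
    have "\<bar>tilde_in \<alpha> k h x $ i\<bar> \<le> C * (kappa \<alpha> x powr (- (1 + \<epsilon>)))"
      using \<delta>(2)[OF that] by simp
    also have "\<dots> \<le> C * (1 - qpoly \<alpha> x)"
      using kappa_powr_le[where \<alpha>=\<alpha>, OF \<alpha> that(2) \<open>\<epsilon> \<ge> 0\<close>] C(1) by (intro mult_left_mono) auto
    finally show ?thesis .
  qed
  with C(1) \<delta>(1) show ?thesis by (intro that[of C \<delta>]) auto
qed

text \<open>The term h of the rescaled equation, with the scale as a free parameter. Unlike
  \<open>kappa\<close> in \<open>tilde_in\<close>, the scale does not depend on the point;
  \<open>compactified_scale\<close> bridges this difference.\<close>

definition rescaled :: "('n::finite \<Rightarrow> nat) \<Rightarrow> real \<Rightarrow> (real^'n \<Rightarrow> real^'n) \<Rightarrow> real \<Rightarrow> real^'n \<Rightarrow> real^'n" where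
  "rescaled \<alpha> k h \<sigma> Y = (\<chi> i. \<sigma> powr (- (k + real (\<alpha> i))) * h (qscale \<alpha> \<sigma> Y) $ i)"

lemma rescaled_eq_tilde_in:
  fixes \<alpha> :: "'n::finite \<Rightarrow> nat"
  assumes \<alpha>: "\<And>i. \<alpha> i > 0" and "b > 0" "\<sigma> > 0"
    and b: "b ^ (2 * lcm_type \<alpha>) * qpoly \<alpha> Y + b / \<sigma> = 1"
  shows "rescaled \<alpha> k h \<sigma> Y $ i = b powr (- (k + real (\<alpha> i))) * tilde_in \<alpha> k h (qscale \<alpha> b Y) $ i"
    and "1 - qpoly \<alpha> (qscale \<alpha> b Y) = b / \<sigma>"
proof -
  show eq: "1 - qpoly \<alpha> (qscale \<alpha> b Y) = b / \<sigma>"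
    using b by (simp add: qpoly_qscale)
  have kap: "kappa \<alpha> (qscale \<alpha> b Y) = \<sigma> / b"
    unfolding kappa_qpoly[where \<alpha>=\<alpha>, OF \<alpha>] eq by simp
  have q: "qscale \<alpha> (\<sigma> / b) (qscale \<alpha> b Y) = qscale \<alpha> \<sigma> Y"
    using assms(2) by (simp add: qscale_def vec_eq_iff power_divide)
  have "\<sigma> powr e = b powr e * (\<sigma> / b) powr e" for e
    using assms(2,3) by (simp add: powr_mult[symmetric])
  then show "rescaled \<alpha> k h \<sigma> Y $ i = b powr (- (k + real (\<alpha> i))) * tilde_in \<alpha> k h (qscale \<alpha> b Y) $ i"
    by (simp add: rescaled_def tilde_in_def kap q)
qed

text \<open>In the variable x the component is b^e f~(x) with e = -(k + \<alpha> i). A difference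
  splits into the change of b^e times a value of order 1/\<sigma>, and a bounded factor times the
  change of f~, whose Lipschitz constant is arbitrarily small near the horizon. Both b and x are
  Lipschitz in Y uniformly in \<sigma>.\<close>

lemma rescaled_component_small:
  fixes \<alpha> :: "'n::finite \<Rightarrow> nat" and h :: "real^'n \<Rightarrow> real^'n"
  assumes \<alpha>: "\<And>i. \<alpha> i > 0" and k: "k > 0" and h: "\<And>y. h differentiable (at y)"
    and \<epsilon>: "\<epsilon> \<ge> 0"
    and O: "(\<lambda>x. tilde_in \<alpha> k h x $ i) \<in> O[to_horizon \<alpha>](\<lambda>x. kappa \<alpha> x powr (- (1 + \<epsilon>)))"
    and o: "\<And>l. (\<lambda>x. frechet_derivative (\<lambda>z. tilde_in \<alpha> k h z $ i) (at x) (axis l 1))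
               \<in> o[to_horizon \<alpha>](\<lambda>x. kappa \<alpha> x powr (- (1 + \<epsilon>)))"
    and Y0: "Y0 \<noteq> 0" and \<eta>: "\<eta> > 0"
  shows "\<exists>\<rho> \<sigma>0 C. \<rho> > 0 \<and> \<sigma>0 > 0 \<and>
    (\<forall>\<sigma> Y Y'. \<sigma> \<ge> \<sigma>0 \<longrightarrow> Y \<in> cball Y0 \<rho> \<longrightarrow> Y' \<in> cball Y0 \<rho> \<longrightarrow>
      \<bar>rescaled \<alpha> k h \<sigma> Y $ i - rescaled \<alpha> k h \<sigma> Y' $ i\<bar> \<le> \<eta> * norm (Y - Y')) \<and>
    (\<forall>\<sigma>. \<sigma> \<ge> \<sigma>0 \<longrightarrow> \<bar>rescaled \<alpha> k h \<sigma> Y0 $ i\<bar> \<le> C / \<sigma>)"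
proof -
  define e where "e = - (k + real (\<alpha> i))"
  define tr where "tr x = tilde_in \<alpha> k h x $ i" for x
  obtain B :: "real \<Rightarrow> real^'n \<Rightarrow> real" and m M Cb \<rho>1 \<tau>1
    where m: "0 < m" and Cb: "0 \<le> Cb" and \<rho>1: "0 < \<rho>1" and \<tau>1: "0 < \<tau>1"
      and B: "\<And>\<tau> Y. 0 < \<tau> \<Longrightarrow> \<tau> \<le> \<tau>1 \<Longrightarrow> Y \<in> cball Y0 \<rho>1 \<Longrightarrow>
          B \<tau> Y \<in> {m..M} \<and> B \<tau> Y ^ (2 * lcm_type \<alpha>) * qpoly \<alpha> Y + B \<tau> Y * \<tau> = 1"
      and Blip: "\<And>\<tau> Y Y'. 0 < \<tau> \<Longrightarrow> \<tau> \<le> \<tau>1 \<Longrightarrow> Y \<in> cball Y0 \<rho>1 \<Longrightarrow> Y' \<in> cball Y0 \<rho>1 \<Longrightarrow>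
          \<bar>B \<tau> Y - B \<tau> Y'\<bar> \<le> Cb * norm (Y - Y')"
    apply (rule compactified_scale[where \<alpha>=\<alpha>, OF \<alpha> Y0])
    subgoal for B m M C \<rho> \<tau>1 by (rule that[of m C \<rho> \<tau>1 B M]) assumption+
    done
  have "m \<le> M" using B[of \<tau>1 Y0] \<tau>1 \<rho>1 by auto
  then have M: "M > 0" using m by linarith
  define R where "R = max (norm Y0 + \<rho>1) M"
  have R: "R > 0" using M by (simp add: R_def)
  obtain Cx where Cx: "Cx \<ge> 0" "\<And>b b' x y. \<bar>b\<bar> \<le> R \<Longrightarrow> \<bar>b'\<bar> \<le> R \<Longrightarrow> norm x \<le> R \<Longrightarrow> norm y \<le> R \<Longrightarrow>
       norm (qscale \<alpha> b x - qscale \<alpha> b' y) \<le> Cx * (\<bar>b - b'\<bar> + norm (x - y))"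
    by (rule qscale_Lipschitz[of R \<alpha>]) blast
  define L where "L = Cx * (Cb + 1)"
  have L: "L \<ge> 0" using Cx Cb by (simp add: L_def)
  define R2 where "R2 = Cx * R"
  obtain Cq where Cq: "Cq \<ge> 0"
    "\<And>x y. norm x \<le> R2 \<Longrightarrow> norm y \<le> R2 \<Longrightarrow> \<bar>qpoly \<alpha> x - qpoly \<alpha> y\<bar> \<le> Cq * norm (x - y)"
    by (rule qpoly_Lipschitz[of R2 \<alpha>]) blast
  obtain Cp where Cp: "Cp \<ge> 0"
    "\<And>u v. u \<in> {m..M} \<Longrightarrow> v \<in> {m..M} \<Longrightarrow> \<bar>u powr e - v powr e\<bar> \<le> Cp * \<bar>u - v\<bar>"
    by (rule powr_Lipschitz[OF m, where M=M and e=e]) blast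
  define Mp where "Mp = m powr e"
  have Mp: "Mp > 0" using m by (simp add: Mp_def)
  have Mp_le: "b powr e \<le> Mp" if "b \<in> {m..M}" for b
    unfolding Mp_def using that m k by (intro powr_mono2') (auto simp: e_def)
  obtain Ct \<delta>1 where Ct: "Ct \<ge> 0" and \<delta>1: "\<delta>1 > 0"
    "\<And>x. 1 - \<delta>1 < qpoly \<alpha> x \<Longrightarrow> qpoly \<alpha> x < 1 \<Longrightarrow> \<bar>tr x\<bar> \<le> Ct * (1 - qpoly \<alpha> x)"
    using tilde_in_bound[where \<alpha>=\<alpha>, OF \<alpha> \<epsilon> O] unfolding tr_def by metis
  \<comment> \<open>Chosen so that the change of \<open>tr\<close>, after the factors
    \<open>Mp\<close> and \<open>L\<close>, costs at most half of \<open>\<eta>\<close>; the summand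
    1 avoids division by 0.\<close>
  define \<eta>' where "\<eta>' = \<eta> / (2 * Mp * (L + 1))"
  have \<eta>': "\<eta>' > 0" using \<eta> Mp L by (simp add: \<eta>'_def)
  obtain \<delta>2 where \<delta>2: "\<delta>2 > 0"
    "\<And>x y. (\<And>z. z \<in> closed_segment x y \<Longrightarrow> 1 - \<delta>2 < qpoly \<alpha> z \<and> qpoly \<alpha> z < 1) \<Longrightarrow>
      \<bar>tr x - tr y\<bar> \<le> \<eta>' * norm (x - y)"
    using tilde_in_Lipschitz[where h=h and \<alpha>=\<alpha> and k=k and i=i, OF \<alpha> h \<epsilon> \<eta>' o] unfolding tr_def by metis
  define \<delta> where "\<delta> = min \<delta>1 \<delta>2"
  have \<delta>: "\<delta> > 0" "\<delta> \<le> \<delta>1" "\<delta> \<le> \<delta>2" using \<delta>1 \<delta>2 by (auto simp: \<delta>_def)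
  \<comment> \<open>This radius lets \<open>qpoly\<close> vary by at most \<delta>/4 along the
    segment between two compactified points. In the next line \<delta>/(4M) places these points
    within \<delta>/4 of the horizon, measured by \<open>1 - qpoly\<close>, and the last bound gives
    the change of b^e the other half of \<open>\<eta>\<close>.\<close>
  define \<rho> where "\<rho> = min \<rho>1 (\<delta> / (8 * (Cq * L + 1)))"
  define \<tau>2 where "\<tau>2 = min \<tau>1 (min (\<delta> / (4 * M)) (\<eta> / (2 * (Cp * Cb * Ct * M + 1))))"
  define K where "K = Cp * Cb * Ct * M"
  have K: "K \<ge> 0" using Cp Cb Ct M by (simp add: K_def)
  have CqL: "Cq * L \<ge> 0" using Cq L by simp
  have \<rho>: "\<rho> > 0" "\<rho> \<le> \<rho>1" using \<rho>1 \<delta> CqL by (auto simp: \<rho>_def)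
  have \<tau>2: "\<tau>2 > 0" "\<tau>2 \<le> \<tau>1" using \<tau>1 \<delta> M \<eta> K by (auto simp: \<tau>2_def K_def[symmetric])
  have point: "b \<in> {m..M}" "1 - qpoly \<alpha> (qscale \<alpha> b Y) = b * \<tau>" "norm (qscale \<alpha> b Y) \<le> R2"
      "rescaled \<alpha> k h (1 / \<tau>) Y $ i = b powr e * tr (qscale \<alpha> b Y)"
      "b * \<tau> > 0" "b * \<tau> \<le> M * \<tau>" "M * \<tau> \<le> \<delta> / 4" "K * \<tau> \<le> \<eta> / 2" "norm Y \<le> R"
    if \<tau>: "0 < \<tau>" "\<tau> \<le> \<tau>2" and Y: "Y \<in> cball Y0 \<rho>" and b: "b = B \<tau> Y" for \<tau> Y b
  proof -
    have Y1: "Y \<in> cball Y0 \<rho>1" using Y \<rho> by auto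
    have B1: "b \<in> {m..M}" "b ^ (2 * lcm_type \<alpha>) * qpoly \<alpha> Y + b / (1 / \<tau>) = 1"
      using B[OF \<tau>(1) order_trans[OF \<tau>(2) \<tau>2(2)] Y1] by (auto simp: b)
    have b0: "b > 0" using B1 m by auto
    have "1 / \<tau> > 0" using \<tau> by simp
    note r = rescaled_eq_tilde_in[where \<alpha>=\<alpha>, OF \<alpha> b0 this B1(2)]
    show "b \<in> {m..M}" by (rule B1)
    show "1 - qpoly \<alpha> (qscale \<alpha> b Y) = b * \<tau>" using r(2) by simp
    show "rescaled \<alpha> k h (1 / \<tau>) Y $ i = b powr e * tr (qscale \<alpha> b Y)"
      using r(1) by (simp add: e_def tr_def)
    show YR: "norm Y \<le> R"
      using Y1 norm_triangle_ineq2[of Y Y0] by (auto simp: R_def dist_norm norm_minus_commute)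
    have bR: "\<bar>b\<bar> \<le> R" using B1 b0 by (auto simp: R_def)
    have "qscale \<alpha> b 0 = 0" by (simp add: qscale_def vec_eq_iff)
    then have "norm (qscale \<alpha> b Y) \<le> Cx * norm Y"
      using Cx(2)[OF bR bR YR, of 0] R by simp
    also have "\<dots> \<le> R2" unfolding R2_def using YR Cx by (intro mult_left_mono) auto
    finally show "norm (qscale \<alpha> b Y) \<le> R2" .
    show "b * \<tau> > 0" using b0 \<tau> by simp
    show "b * \<tau> \<le> M * \<tau>" using B1 \<tau> by (intro mult_right_mono) auto
    have "\<tau> \<le> \<delta> / (4 * M)" using \<tau> by (simp add: \<tau>2_def)
    then show "M * \<tau> \<le> \<delta> / 4" using M by (simp add: field_simps)
    have "\<tau> \<le> \<eta> / (2 * (K + 1))" using \<tau> by (simp add: \<tau>2_def K_def)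
    then have "(K + 1) * \<tau> \<le> \<eta> / 2" using K by (simp add: field_simps)
    then show "K * \<tau> \<le> \<eta> / 2" using \<tau> by (simp add: algebra_simps)
  qed
  have lip: "\<bar>rescaled \<alpha> k h (1 / \<tau>) Y $ i - rescaled \<alpha> k h (1 / \<tau>) Y' $ i\<bar> \<le> \<eta> * norm (Y - Y')"
    if \<tau>: "0 < \<tau>" "\<tau> \<le> \<tau>2" and Y: "Y \<in> cball Y0 \<rho>" and Y': "Y' \<in> cball Y0 \<rho>" for \<tau> Y Y'
  proof -
    define b b' where "b = B \<tau> Y" and "b' = B \<tau> Y'"
    define x x' where "x = qscale \<alpha> b Y" and "x' = qscale \<alpha> b' Y'"
    note p = point[OF \<tau> Y b_def, folded x_def] and p' = point[OF \<tau> Y' b'_def, folded x'_def]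
    have bb: "\<bar>b - b'\<bar> \<le> Cb * norm (Y - Y')"
      unfolding b_def b'_def using \<tau> \<tau>2 Y Y' \<rho> by (intro Blip) auto
    have "norm (x - x') \<le> Cx * (\<bar>b - b'\<bar> + norm (Y - Y'))"
      unfolding x_def x'_def using p(1,9) p'(1,9) m by (intro Cx(2)) (auto simp: R_def)
    also have "\<dots> \<le> Cx * (Cb * norm (Y - Y') + norm (Y - Y'))"
      using bb Cx(1) by (intro mult_left_mono) auto
    finally have xx: "norm (x - x') \<le> L * norm (Y - Y')"
      by (simp add: L_def algebra_simps)
    have YY: "norm (Y - Y') \<le> 2 * \<rho>"
      using Y Y' norm_triangle_ineq4[of "Y - Y0" "Y' - Y0"] by (simp add: dist_norm norm_minus_commute)
    \<comment> \<open>The two bounds have different reasons: convexity keeps the segment below the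
      horizon, while only its shortness keeps it from leaving the layer on the inner side.\<close>
    have seg: "1 - \<delta> < qpoly \<alpha> z \<and> qpoly \<alpha> z < 1" if z: "z \<in> closed_segment x x'" for z
    proof
      show "qpoly \<alpha> z < 1" by (rule qpoly_convex[OF _ _ z]) (use p(2,5) p'(2,5) in auto)
      have "z \<in> cball 0 R2"
        using z p(3) p'(3) closed_segment_subset[of x "cball 0 R2" x'] by auto
      then have "\<bar>qpoly \<alpha> x - qpoly \<alpha> z\<bar> \<le> Cq * norm (x - z)" using p(3) by (intro Cq(2)) auto
      also have "\<dots> \<le> Cq * (L * norm (Y - Y'))"
        using segment_bound1[OF z] xx Cq(1) by (intro mult_left_mono) (auto simp: norm_minus_commute)
      also have "\<dots> \<le> Cq * L * (2 * \<rho>)"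
        using mult_left_mono[OF YY CqL] by (simp only: mult.assoc)
      also have "\<dots> \<le> (Cq * L + 1) * (2 * (\<delta> / (8 * (Cq * L + 1))))"
        using CqL \<rho> by (intro mult_mono) (auto simp: \<rho>_def)
      also have "\<dots> = \<delta> / 4" using CqL by (simp add: field_simps)
      finally show "1 - \<delta> < qpoly \<alpha> z" using p(2,6,7) \<delta>(1) by linarith
    qed
    have "\<bar>tr x\<bar> \<le> Ct * (1 - qpoly \<alpha> x)"
      using seg[of x] \<delta> by (intro \<delta>1(2)) auto
    also have "\<dots> \<le> Ct * (M * \<tau>)" using p(2,6) Ct by (intro mult_left_mono) auto
    finally have tx: "\<bar>tr x\<bar> \<le> Ct * (M * \<tau>)" .
    have txx: "\<bar>tr x - tr x'\<bar> \<le> \<eta>' * norm (x - x')"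
      using seg \<delta> by (intro \<delta>2(2)) force
    have "\<bar>rescaled \<alpha> k h (1 / \<tau>) Y $ i - rescaled \<alpha> k h (1 / \<tau>) Y' $ i\<bar>
        = \<bar>(b powr e - b' powr e) * tr x + b' powr e * (tr x - tr x')\<bar>"
      unfolding p(4) p'(4) by (simp add: algebra_simps)
    also have "\<dots> \<le> \<bar>b powr e - b' powr e\<bar> * \<bar>tr x\<bar> + b' powr e * \<bar>tr x - tr x'\<bar>"
      by (rule order_trans[OF abs_triangle_ineq]) (simp add: abs_mult)
    also have "\<dots> \<le> (Cp * (Cb * norm (Y - Y'))) * (Ct * (M * \<tau>)) + Mp * (\<eta>' * (L * norm (Y - Y')))"
    proof (intro add_mono mult_mono)
      have "\<bar>b powr e - b' powr e\<bar> \<le> Cp * \<bar>b - b'\<bar>" by (rule Cp(2)[OF p(1) p'(1)])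
      also have "\<dots> \<le> Cp * (Cb * norm (Y - Y'))" using bb Cp(1) by (intro mult_left_mono)
      finally show "\<bar>b powr e - b' powr e\<bar> \<le> Cp * (Cb * norm (Y - Y'))" .
      have "\<eta>' * norm (x - x') \<le> \<eta>' * (L * norm (Y - Y'))" using xx \<eta>' by (intro mult_left_mono) auto
      with txx show "\<bar>tr x - tr x'\<bar> \<le> \<eta>' * (L * norm (Y - Y'))" by linarith
    qed (use tx Mp_le[OF p'(1)] Cp Cb Mp in auto)
    also have "\<dots> = (K * \<tau>) * norm (Y - Y') + (\<eta> / 2 * (L / (L + 1))) * norm (Y - Y')"
      using Mp L by (simp add: K_def \<eta>'_def)
    also have "\<dots> \<le> \<eta> / 2 * norm (Y - Y') + \<eta> / 2 * norm (Y - Y')"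
    proof (intro add_mono mult_right_mono)
      have "L / (L + 1) \<le> 1" using L by simp
      from mult_left_mono[OF this, of "\<eta> / 2"] show "\<eta> / 2 * (L / (L + 1)) \<le> \<eta> / 2" using \<eta> by simp
    qed (use p(8) in auto)
    finally show ?thesis by simp
  qed
  have bound: "\<bar>rescaled \<alpha> k h (1 / \<tau>) Y0 $ i\<bar> \<le> Mp * Ct * M * \<tau>" if \<tau>: "0 < \<tau>" "\<tau> \<le> \<tau>2" for \<tau>
  proof -
    define b where "b = B \<tau> Y0"
    have Y: "Y0 \<in> cball Y0 \<rho>" using \<rho> by simp
    note p = point[OF \<tau> Y b_def]
    have "\<bar>tr (qscale \<alpha> b Y0)\<bar> \<le> Ct * (1 - qpoly \<alpha> (qscale \<alpha> b Y0))"
      by (intro \<delta>1(2)) (use p(2,5,6,7) \<delta> in linarith)+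
    also have "\<dots> \<le> Ct * (M * \<tau>)" using p(2,6) Ct by (intro mult_left_mono) auto
    finally have "b powr e * \<bar>tr (qscale \<alpha> b Y0)\<bar> \<le> Mp * (Ct * (M * \<tau>))"
      using Mp_le[OF p(1)] Mp by (intro mult_mono) auto
    then show ?thesis unfolding p(4) by (simp add: abs_mult mult.assoc)
  qed
  have inv: "0 < 1 / \<sigma>" "1 / \<sigma> \<le> \<tau>2" if "\<sigma> \<ge> 1 / \<tau>2" for \<sigma> :: real
  proof -
    have "0 < 1 / \<tau>2" using \<tau>2 by simp
    then have "\<sigma> > 0" using that by linarith
    then show "0 < 1 / \<sigma>" "1 / \<sigma> \<le> \<tau>2" using that \<tau>2 by (auto simp: field_simps)
  qed
  show ?thesis
  proof (rule exI[of _ \<rho>], rule exI[of _ "1 / \<tau>2"], rule exI[of _ "Mp * Ct * M"], intro conjI allI impI)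
    show "\<rho> > 0" "1 / \<tau>2 > 0" using \<rho> \<tau>2 by auto
    show "\<bar>rescaled \<alpha> k h \<sigma> Y $ i - rescaled \<alpha> k h \<sigma> Y' $ i\<bar> \<le> \<eta> * norm (Y - Y')"
      if "\<sigma> \<ge> 1 / \<tau>2" "Y \<in> cball Y0 \<rho>" "Y' \<in> cball Y0 \<rho>" for \<sigma> Y Y'
      using lip[OF inv[OF that(1)] that(2,3)] by simp
    show "\<bar>rescaled \<alpha> k h \<sigma> Y0 $ i\<bar> \<le> Mp * Ct * M / \<sigma>" if "\<sigma> \<ge> 1 / \<tau>2" for \<sigma>
      using bound[OF inv[OF that]] by simp
  qed
qed

section \<open>The blow-up solution\<close>

lemma has_vector_derivative_vecI:
  fixes y :: "real \<Rightarrow> real^'n::finite"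
  assumes "\<And>i. ((\<lambda>t. y t $ i) has_vector_derivative D $ i) F"
  shows "(y has_vector_derivative D) F"
proof -
  have "((\<lambda>t. \<Sum>i\<in>UNIV. y t $ i *\<^sub>R axis i (1::real)) has_vector_derivative (\<Sum>i\<in>UNIV. D $ i *\<^sub>R axis i 1)) F"
    by (intro has_vector_derivative_sum
        bounded_linear.has_vector_derivative[OF bounded_linear_scaleR_left] assms)
  moreover have "(\<Sum>i\<in>UNIV. v $ i *\<^sub>R axis i 1) = v" for v :: "real^'n"
    using basis_expansion[of v] by (simp add: scalar_mult_eq_scaleR)
  ultimately show ?thesis by simp
qed

text \<open>The remainder has derivative DF(Y + v) - DF(Y), which is small near \<open>Y\<close>.
  \<open>C_r_map\<close> provides continuity only of the partial derivatives, so the operator norm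
  is controlled by the continuous function \<open>q\<close>, which vanishes at
  \<open>Y\<close>.\<close>

lemma C1_remainder_Lipschitz:
  fixes F :: "real^'n::finite \<Rightarrow> real^'n"
  assumes F: "C_r_map 1 F" and \<eta>: "\<eta> > 0"
  obtains \<rho> where "\<rho> > 0"
    and "\<And>v w. norm v \<le> \<rho> \<Longrightarrow> norm w \<le> \<rho> \<Longrightarrow>
      norm ((F (Y + v) - jacobian F (at Y) *v v) - (F (Y + w) - jacobian F (at Y) *v w)) \<le> \<eta> * norm (v - w)"
proof -
  define D where "D x = frechet_derivative F (at x)" for x
  have diff: "F differentiable (at x)" for x using F by simp
  have der: "(F has_derivative D x) (at x)" for x
    using diff unfolding D_def frechet_derivative_works .
  have lin: "linear (D x)" for x by (rule has_derivative_linear[OF der])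
  have J: "jacobian F (at Y) *v v = D Y v" for v
  proof -
    have "(F has_derivative (*v) (jacobian F (at Y))) (at Y)"
      using diff jacobian_works by blast
    from has_derivative_unique[OF this der] show ?thesis by (rule fun_cong)
  qed
  define q where "q x = (\<Sum>b\<in>Basis. norm (D x b - D Y b))" for x
  have "continuous_on UNIV (\<lambda>x. D x b)" if "b \<in> Basis" for b
    using F that by (simp add: D_def)
  then have "continuous_on UNIV q"
    unfolding q_def by (intro continuous_intros) auto
  then have "isCont q Y" by (simp add: continuous_on_eq_continuous_at)
  moreover have "q Y < \<eta>" using \<eta> by (simp add: q_def)
  ultimately have "\<forall>\<^sub>F x in nhds Y. q x < \<eta>"
    using continuous_at_imp_continuous_at_within isContD tendsto_at_iff_tendsto_nhds order_tendstoD(2)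
    by (metis isCont_def)
  then obtain e where e: "e > 0" "\<And>x. dist x Y < e \<Longrightarrow> q x < \<eta>"
    unfolding eventually_nhds_metric by blast
  define \<rho> where "\<rho> = e / 2"
  have on: "onorm (\<lambda>v. D x v - D Y v) \<le> \<eta>" if "dist x Y < e" for x
  proof (rule onorm_bound)
    fix v :: "real^'n"
    have "D u v = D u (\<Sum>b\<in>Basis. (v \<bullet> b) *\<^sub>R b)" for u
      by (simp only: euclidean_representation)
    then have "D u v = (\<Sum>b\<in>Basis. (v \<bullet> b) *\<^sub>R D u b)" for u
      by (simp only: linear_sum[OF lin] linear_scale[OF lin])
    then have "D x v - D Y v = (\<Sum>b\<in>Basis. (v \<bullet> b) *\<^sub>R (D x b - D Y b))"
      by (simp only: sum_subtractf scaleR_diff_right)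
    also have "norm \<dots> \<le> (\<Sum>b\<in>Basis. norm v * norm (D x b - D Y b))"
      by (intro sum_norm_le) (auto intro!: mult_right_mono Basis_le_norm)
    also have "\<dots> = norm v * q x" by (simp add: q_def sum_distrib_left)
    also have "\<dots> \<le> \<eta> * norm v" using mult_right_mono[OF less_imp_le[OF e(2)[OF that]], of "norm v"] by (simp add: mult.commute)
    finally show "norm (D x v - D Y v) \<le> \<eta> * norm v" .
  qed (use \<eta> in auto)
  show ?thesis
  proof (rule that[of \<rho>])
    show "\<rho> > 0" using e by (simp add: \<rho>_def)
    fix v w :: "real^'n" assume vw: "norm v \<le> \<rho>" "norm w \<le> \<rho>"
    show "norm ((F (Y + v) - jacobian F (at Y) *v v) - (F (Y + w) - jacobian F (at Y) *v w)) \<le> \<eta> * norm (v - w)"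
      unfolding J
    proof (rule differentiable_bound[where S="cball 0 \<rho>" and f'="\<lambda>u h. D (Y + u) h - D Y h"])
      fix u :: "real^'n" assume u: "u \<in> cball 0 \<rho>"
      have "((\<lambda>u. F (Y + u)) has_derivative (\<lambda>h. D (Y + u) h)) (at u within cball 0 \<rho>)"
        by (rule has_derivative_compose[of "\<lambda>u. Y + u" "\<lambda>h. h", OF _ der])
          (auto intro!: derivative_eq_intros)
      then show "((\<lambda>u. F (Y + u) - D Y u) has_derivative (\<lambda>h. D (Y + u) h - D Y h)) (at u within cball 0 \<rho>)"
        by (intro has_derivative_diff linear_imp_has_derivative lin)
      show "onorm (\<lambda>h. D (Y + u) h - D Y h) \<le> \<eta>"
        using u e(1) by (intro on) (auto simp: dist_norm \<rho>_def)
    qed (use vw in auto)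
  qed
qed

lemma rescaled_small:
  fixes \<alpha> :: "'n::finite \<Rightarrow> nat" and h :: "real^'n \<Rightarrow> real^'n"
  assumes \<alpha>: "\<And>i. \<alpha> i > 0" and k: "k > 0" and h: "\<And>y. h differentiable (at y)"
    and \<epsilon>: "\<epsilon> \<ge> 0"
    and O: "\<And>i. (\<lambda>x. tilde_in \<alpha> k h x $ i) \<in> O[to_horizon \<alpha>](\<lambda>x. kappa \<alpha> x powr (- (1 + \<epsilon>)))"
    and o: "\<And>i l. (\<lambda>x. frechet_derivative (\<lambda>z. tilde_in \<alpha> k h z $ i) (at x) (axis l 1))
               \<in> o[to_horizon \<alpha>](\<lambda>x. kappa \<alpha> x powr (- (1 + \<epsilon>)))"
    and Y0: "Y0 \<noteq> 0" and \<eta>: "\<eta> > 0"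
  shows "\<exists>\<rho> \<sigma>0 C. \<rho> > 0 \<and> \<sigma>0 > 0 \<and>
    (\<forall>\<sigma> Y Y'. \<sigma> \<ge> \<sigma>0 \<longrightarrow> Y \<in> cball Y0 \<rho> \<longrightarrow> Y' \<in> cball Y0 \<rho> \<longrightarrow>
      norm (rescaled \<alpha> k h \<sigma> Y - rescaled \<alpha> k h \<sigma> Y') \<le> \<eta> * norm (Y - Y')) \<and>
    (\<forall>\<sigma>. \<sigma> \<ge> \<sigma>0 \<longrightarrow> norm (rescaled \<alpha> k h \<sigma> Y0) \<le> C / \<sigma>)"
proof -
  define \<eta>' where "\<eta>' = \<eta> / real CARD('n)"
  have \<eta>': "\<eta>' > 0" using \<eta> by (simp add: \<eta>'_def)
  have "\<forall>i. \<exists>\<rho> \<sigma>0 C. \<rho> > 0 \<and> \<sigma>0 > 0 \<and>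
    (\<forall>\<sigma> Y Y'. \<sigma> \<ge> \<sigma>0 \<longrightarrow> Y \<in> cball Y0 \<rho> \<longrightarrow> Y' \<in> cball Y0 \<rho> \<longrightarrow>
      \<bar>rescaled \<alpha> k h \<sigma> Y $ i - rescaled \<alpha> k h \<sigma> Y' $ i\<bar> \<le> \<eta>' * norm (Y - Y')) \<and>
    (\<forall>\<sigma>. \<sigma> \<ge> \<sigma>0 \<longrightarrow> \<bar>rescaled \<alpha> k h \<sigma> Y0 $ i\<bar> \<le> C / \<sigma>)"
    using rescaled_component_small[where \<alpha>=\<alpha> and k=k and h=h, OF \<alpha> k h \<epsilon> O o Y0 \<eta>'] by (rule allI)
  then obtain \<rho>' \<sigma>' C' where *: "\<And>i. \<rho>' i > 0" "\<And>i. \<sigma>' i > 0"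
    "\<And>i \<sigma> Y Y'. \<sigma> \<ge> \<sigma>' i \<Longrightarrow> Y \<in> cball Y0 (\<rho>' i) \<Longrightarrow> Y' \<in> cball Y0 (\<rho>' i) \<Longrightarrow>
      \<bar>rescaled \<alpha> k h \<sigma> Y $ i - rescaled \<alpha> k h \<sigma> Y' $ i\<bar> \<le> \<eta>' * norm (Y - Y')"
    "\<And>i \<sigma>. \<sigma> \<ge> \<sigma>' i \<Longrightarrow> \<bar>rescaled \<alpha> k h \<sigma> Y0 $ i\<bar> \<le> C' i / \<sigma>"
    unfolding choice_iff by blast
  define \<rho> where "\<rho> = Min (range \<rho>')"
  define \<sigma>0 where "\<sigma>0 = Max (range \<sigma>')"
  have \<rho>: "\<rho> \<le> \<rho>' i" and \<sigma>0: "\<sigma>' i \<le> \<sigma>0" for i by (auto simp: \<rho>_def \<sigma>0_def)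
  show ?thesis
  proof (rule exI[of _ \<rho>], rule exI[of _ \<sigma>0], rule exI[of _ "\<Sum>i\<in>UNIV. C' i"], intro conjI allI impI)
    show "\<rho> > 0" using *(1) by (simp add: \<rho>_def)
    show "\<sigma>0 > 0" using *(2)[of undefined] \<sigma>0[of undefined] by linarith
    show "norm (rescaled \<alpha> k h \<sigma> Y - rescaled \<alpha> k h \<sigma> Y') \<le> \<eta> * norm (Y - Y')"
      if "\<sigma> \<ge> \<sigma>0" "Y \<in> cball Y0 \<rho>" "Y' \<in> cball Y0 \<rho>" for \<sigma> Y Y'
    proof -
      have "norm (rescaled \<alpha> k h \<sigma> Y - rescaled \<alpha> k h \<sigma> Y')
          \<le> (\<Sum>i\<in>UNIV. \<bar>(rescaled \<alpha> k h \<sigma> Y - rescaled \<alpha> k h \<sigma> Y') $ i\<bar>)"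
        by (rule norm_le_l1_cart)
      also have "\<dots> \<le> (\<Sum>i\<in>(UNIV::'n set). \<eta>' * norm (Y - Y'))"
      proof (rule sum_mono)
        fix i
        have "\<bar>rescaled \<alpha> k h \<sigma> Y $ i - rescaled \<alpha> k h \<sigma> Y' $ i\<bar> \<le> \<eta>' * norm (Y - Y')"
          by (rule *(3)) (use that \<rho>[of i] \<sigma>0[of i] in auto)
        then show "\<bar>(rescaled \<alpha> k h \<sigma> Y - rescaled \<alpha> k h \<sigma> Y') $ i\<bar> \<le> \<eta>' * norm (Y - Y')" by simp
      qed
      also have "\<dots> = \<eta> * norm (Y - Y')" by (simp add: \<eta>'_def)
      finally show ?thesis .
    qed
    show "norm (rescaled \<alpha> k h \<sigma> Y0) \<le> (\<Sum>i\<in>UNIV. C' i) / \<sigma>" if "\<sigma> \<ge> \<sigma>0" for \<sigma>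
    proof -
      have "norm (rescaled \<alpha> k h \<sigma> Y0) \<le> (\<Sum>i\<in>UNIV. \<bar>rescaled \<alpha> k h \<sigma> Y0 $ i\<bar>)"
        by (rule norm_le_l1_cart)
      also have "\<dots> \<le> (\<Sum>i\<in>UNIV. C' i / \<sigma>)"
        by (rule sum_mono, rule *(4)) (use that \<sigma>0 order_trans in blast)
      finally show ?thesis by (simp add: sum_divide_distrib)
    qed
  qed
qed

section \<open>Construction of the solution in rescaled variables\<close>

lemma continuous_on_rescaled:
  fixes h :: "real^'n::finite \<Rightarrow> real^'n"
  assumes "continuous_on UNIV h" "continuous_on UNIV \<sigma>" "continuous_on UNIV Y" "\<And>t. \<sigma> t > 0"
  shows "continuous_on UNIV (\<lambda>t::real. rescaled \<alpha> k h (\<sigma> t) (Y t))"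
proof -
  have "continuous_on UNIV (\<lambda>t. qscale \<alpha> (\<sigma> t) (Y t))"
    unfolding qscale_def by (intro continuous_on_vec_lambda continuous_intros assms)
  from continuous_on_compose2[OF assms(1) this]
  have "continuous_on UNIV (\<lambda>t. h (qscale \<alpha> (\<sigma> t) (Y t)))" by simp
  from bounded_linear.continuous_on[OF bounded_linear_vec_nth this]
  have hc: "continuous_on UNIV (\<lambda>t. h (qscale \<alpha> (\<sigma> t) (Y t)) $ i)" for i .
  have "\<sigma> t \<noteq> 0" for t using assms(4)[of t] by simp
  then have "continuous_on UNIV (\<lambda>t. \<sigma> t powr c)" for c
    by (intro continuous_on_powr assms(2) continuous_on_const) auto
  then show ?thesis
    unfolding rescaled_def by (intro continuous_on_vec_lambda continuous_on_mult hc)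
qed

text \<open>The order of choices matters: \<open>\<eta>\<close> comes from the matrix, the radius
  from \<open>\<eta>\<close>, and the final threshold for the scale from both. The C^1 remainder of
  \<open>F\<close> and the residual term each receive half of the Lipschitz budget.\<close>

lemma rescaled_limit_solution:
  fixes \<alpha> :: "'n::finite \<Rightarrow> nat" and f F :: "real^'n \<Rightarrow> real^'n"
  assumes \<alpha>: "\<And>i. \<alpha> i > 0" and k: "k > 0"
    and f: "\<And>y. f differentiable (at y)" and F: "C_r_map 1 F"
    and \<epsilon>: "\<epsilon> \<ge> 0"
    and O: "\<And>i. (\<lambda>x. tilde_in \<alpha> k (\<lambda>y. f y - F y) x $ i)
               \<in> O[to_horizon \<alpha>](\<lambda>x. kappa \<alpha> x powr (- (1 + \<epsilon>)))"
    and o: "\<And>i l. (\<lambda>x. frechet_derivative (\<lambda>z. tilde_in \<alpha> k (\<lambda>y. f y - F y) z $ i) (at x) (axis l 1))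
               \<in> o[to_horizon \<alpha>](\<lambda>x. kappa \<alpha> x powr (- (1 + \<epsilon>)))"
    and Y0: "Y0 \<noteq> 0" and bal: "F Y0 = (1 / k) *\<^sub>R (diag_type \<alpha> *v Y0)"
    and hyp: "hyperbolic_matrix (blowup_matrix \<alpha> k F Y0)"
  obtains Y S where "(Y \<longlongrightarrow> Y0) at_top"
    and "\<And>s. s \<ge> S \<Longrightarrow> (Y has_vector_derivative
      F (Y s) - (1 / k) *\<^sub>R (diag_type \<alpha> *v Y s) + rescaled \<alpha> k (\<lambda>y. f y - F y) (exp (s / k)) (Y s)) (at s)"
proof -
  define h where "h y = f y - F y" for y
  define A where "A = blowup_matrix \<alpha> k F Y0"
  have dF: "F differentiable (at y)" for y using F by simp
  have dh: "h differentiable (at y)" for y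
    unfolding h_def[abs_def] by (intro differentiable_diff f dF)
  have ch: "continuous_on UNIV h" and cF: "continuous_on UNIV F"
    by (intro continuous_at_imp_continuous_on ballI differentiable_imp_continuous_within dh dF)+
  obtain \<eta> :: real where \<eta>: "\<eta> > 0"
    and fix_pt: "\<forall>(N :: real \<Rightarrow> real^'n \<Rightarrow> real^'n) \<rho>. \<rho> > 0 \<longrightarrow>
      (\<forall>z. continuous_on UNIV z \<longrightarrow> (\<forall>t. norm (z t) \<le> \<rho>) \<longrightarrow> continuous_on UNIV (\<lambda>t. N t (z t))) \<longrightarrow>
      (\<forall>t v w. norm v \<le> \<rho> \<longrightarrow> norm w \<le> \<rho> \<longrightarrow> norm (N t v - N t w) \<le> \<eta> * norm (v - w)) \<longrightarrow>
      (\<forall>t. norm (N t 0) \<le> \<eta> * \<rho>) \<longrightarrow> ((\<lambda>t. N t 0) \<longlongrightarrow> 0) at_top \<longrightarrow>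
      (\<exists>z. (\<forall>t. norm (z t) \<le> \<rho>) \<and> (z \<longlongrightarrow> 0) at_top \<and>
        (\<forall>t. (z has_vector_derivative A *v z t + N t (z t)) (at t)))"
    using vanishing_solution_of_perturbation[OF hyp[folded A_def]] by (elim exE conjE)
  have \<eta>2: "\<eta> / 2 > 0" using \<eta> by simp
  obtain \<rho>1 where \<rho>1: "\<rho>1 > 0" "\<And>v w. norm v \<le> \<rho>1 \<Longrightarrow> norm w \<le> \<rho>1 \<Longrightarrow>
      norm ((F (Y0 + v) - jacobian F (at Y0) *v v) - (F (Y0 + w) - jacobian F (at Y0) *v w)) \<le> \<eta> / 2 * norm (v - w)"
    using C1_remainder_Lipschitz[OF F \<eta>2, of Y0] by blast
  obtain \<rho>2 \<sigma>0 C where \<rho>2: "\<rho>2 > 0" "\<sigma>0 > 0"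
    "\<And>\<sigma> Y Y'. \<sigma> \<ge> \<sigma>0 \<Longrightarrow> Y \<in> cball Y0 \<rho>2 \<Longrightarrow> Y' \<in> cball Y0 \<rho>2 \<Longrightarrow>
      norm (rescaled \<alpha> k h \<sigma> Y - rescaled \<alpha> k h \<sigma> Y') \<le> \<eta> / 2 * norm (Y - Y')"
    "\<And>\<sigma>. \<sigma> \<ge> \<sigma>0 \<Longrightarrow> norm (rescaled \<alpha> k h \<sigma> Y0) \<le> C / \<sigma>"
    using rescaled_small[where \<alpha>=\<alpha> and k=k and h=h, OF \<alpha> k dh \<epsilon> O[folded h_def] o[folded h_def] Y0 \<eta>2] by blast
  define \<rho> where "\<rho> = min \<rho>1 \<rho>2"
  have \<rho>: "\<rho> > 0" "\<rho> \<le> \<rho>1" "\<rho> \<le> \<rho>2" using \<rho>1 \<rho>2 by (auto simp: \<rho>_def)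
  \<comment> \<open>Beyond this scale \<open>C / \<sigma>\<close> is at most
    \<open>\<eta> * \<rho>\<close>. There is no circularity, since \<open>C\<close> bounds the
    residual at \<open>Y0\<close> only and was obtained before \<open>\<rho>\<close>.\<close>
  define \<sigma>1 where "\<sigma>1 = max \<sigma>0 (C / (\<eta> * \<rho>))"
  have \<sigma>1: "\<sigma>1 \<ge> \<sigma>0" "\<sigma>1 > 0" using \<rho>2 by (auto simp: \<sigma>1_def)
  define S where "S = k * ln \<sigma>1"
  \<comment> \<open>Freezing the scale before \<open>S\<close> gives a nonlinearity on the whole
    line that satisfies the smallness bounds at all times and agrees with the true one from
    \<open>S\<close> on.\<close>
  define \<sigma> where "\<sigma> s = exp (max s S / k)" for s
  have \<sigma>: "\<sigma> s \<ge> \<sigma>1" for s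
  proof -
    have "\<sigma>1 = exp (S / k)" using \<sigma>1 k by (simp add: S_def)
    then show ?thesis using k by (simp add: \<sigma>_def divide_right_mono)
  qed
  then have \<sigma>_ge: "\<sigma> s \<ge> \<sigma>0" for s using \<sigma>1 order_trans by blast
  have \<sigma>_pos: "\<sigma> s > 0" for s by (simp add: \<sigma>_def)
  have c\<sigma>: "continuous_on UNIV \<sigma>" unfolding \<sigma>_def using k by (intro continuous_intros) auto
  \<comment> \<open>The Jacobian term is moved into \<open>A\<close>, and \<open>F Y0\<close> is
    removed because the balance law cancels it against (1/k) \<Lambda> Y0. What remains at
    \<open>v = 0\<close> is the residual alone.\<close>
  define N where "N s v = (F (Y0 + v) - jacobian F (at Y0) *v v) - F Y0 + rescaled \<alpha> k h (\<sigma> s) (Y0 + v)" for s v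
  have N0: "N s 0 = rescaled \<alpha> k h (\<sigma> s) Y0" for s by (simp add: N_def)
  have N0_le: "norm (N s 0) \<le> C / \<sigma> s" for s unfolding N0 by (rule \<rho>2(4)[OF \<sigma>_ge])
  have "\<exists>z. (\<forall>t. norm (z t) \<le> \<rho>) \<and> (z \<longlongrightarrow> 0) at_top \<and>
        (\<forall>t. (z has_vector_derivative A *v z t + N t (z t)) (at t))"
  proof (rule fix_pt[rule_format, OF \<rho>(1)])
    show "continuous_on UNIV (\<lambda>t. N t (z t))" if "continuous_on UNIV z" for z
      unfolding N_def
      by (intro continuous_intros continuous_on_rescaled ch c\<sigma> that \<sigma>_pos
          continuous_on_compose2[OF cF]
          bounded_linear.continuous_on[OF matrix_vector_mul_bounded_linear]) auto
    show "norm (N t v - N t w) \<le> \<eta> * norm (v - w)" if "norm v \<le> \<rho>" "norm w \<le> \<rho>" for t v w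
    proof -
      have "N t v - N t w =
        ((F (Y0 + v) - jacobian F (at Y0) *v v) - (F (Y0 + w) - jacobian F (at Y0) *v w))
        + (rescaled \<alpha> k h (\<sigma> t) (Y0 + v) - rescaled \<alpha> k h (\<sigma> t) (Y0 + w))"
        by (simp add: N_def)
      also have "norm \<dots> \<le> \<eta> / 2 * norm (v - w) + \<eta> / 2 * norm ((Y0 + v) - (Y0 + w))"
        by (intro norm_triangle_mono \<rho>1(2) \<rho>2(3) \<sigma>_ge) (use that \<rho> in \<open>auto simp: dist_norm\<close>)
      finally show ?thesis by simp
    qed
    show "norm (N t 0) \<le> \<eta> * \<rho>" for t
    proof -
      have "C / (\<eta> * \<rho>) \<le> \<sigma> t" using \<sigma>[of t] by (simp add: \<sigma>1_def)
      then have "C / \<sigma> t \<le> \<eta> * \<rho>" using \<eta> \<rho>(1) \<sigma>_pos[of t] by (simp add: field_simps)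
      then show ?thesis using N0_le[of t] by linarith
    qed
    show "((\<lambda>t. N t 0) \<longlongrightarrow> 0) at_top"
    proof (rule Lim_null_comparison[OF always_eventually[OF allI[OF N0_le]]])
      have "filterlim (\<lambda>s. (1 / k) * s) at_top at_top"
        using k by (intro filterlim_tendsto_pos_mult_at_top[OF tendsto_const _ filterlim_ident]) auto
      from filterlim_compose[OF exp_at_top this]
      have "filterlim \<sigma> at_top at_top"
        by (rule filterlim_at_top_mono) (use k in \<open>auto simp: \<sigma>_def divide_right_mono\<close>)
      then show "((\<lambda>s. C / \<sigma> s) \<longlongrightarrow> 0) at_top"
        by (intro tendsto_divide_0[OF tendsto_const] filterlim_at_top_imp_at_infinity)
    qed
  qed
  then obtain z where z: "(z \<longlongrightarrow> 0) at_top"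
    "\<And>t. (z has_vector_derivative A *v z t + N t (z t)) (at t)" by blast
  show ?thesis
  proof (rule that[of "\<lambda>s. Y0 + z s" S])
    show "((\<lambda>s. Y0 + z s) \<longlongrightarrow> Y0) at_top"
      using tendsto_add[OF tendsto_const[of Y0] z(1)] by simp
    fix s assume s: "s \<ge> S"
    have "((\<lambda>s. Y0 + z s) has_vector_derivative 0 + (A *v z s + N s (z s))) (at s)"
      by (intro has_vector_derivative_add has_vector_derivative_const z(2))
    moreover have "A *v z s + N s (z s) = F (Y0 + z s) - (1 / k) *\<^sub>R (diag_type \<alpha> *v (Y0 + z s))
        + rescaled \<alpha> k (\<lambda>y. f y - F y) (exp (s / k)) (Y0 + z s)"
    proof -
      have "A *v z s = jacobian F (at Y0) *v z s - (1 / k) *\<^sub>R (diag_type \<alpha> *v z s)"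
        unfolding A_def blowup_matrix_def
        by (simp add: matrix_vector_mult_diff_rdistrib scaleR_matrix_vector_assoc)
      moreover have "max s S = s" using s by simp
      ultimately show ?thesis
        by (simp add: N_def \<sigma>_def h_def[abs_def] bal matrix_vector_right_distrib scaleR_add_right)
    qed
    ultimately show "((\<lambda>s. Y0 + z s) has_vector_derivative F (Y0 + z s) - (1 / k) *\<^sub>R (diag_type \<alpha> *v (Y0 + z s))
        + rescaled \<alpha> k (\<lambda>y. f y - F y) (exp (s / k)) (Y0 + z s)) (at s)" by simp
  qed
qed

text \<open>Undoing the change of variables produces the factor ds/dt = e^s = \<sigma>^k.
  Differentiating \<sigma>^(\<alpha> i) contributes (\<alpha> i / k) Y_i, which cancels the linear
  term. By quasi-homogeneity \<sigma>^(k + \<alpha> i) F(Y) is F at the scaled point, which cancels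
  the F inside the residual and leaves f.\<close>

lemma solves_on_from_rescaled:
  fixes \<alpha> :: "'n::finite \<Rightarrow> nat" and f F :: "real^'n \<Rightarrow> real^'n"
  assumes k: "k > 0" and qh: "quasi_homogeneous \<alpha> k F" and t: "t < 0"
    and Y: "(Y has_vector_derivative
      F (Y s) - (1 / k) *\<^sub>R (diag_type \<alpha> *v Y s) + rescaled \<alpha> k (\<lambda>y. f y - F y) (exp (s / k)) (Y s)) (at s)"
    and s: "s = - ln (- t)"
  shows "((\<lambda>t. qscale \<alpha> (exp (- ln (- t) / k)) (Y (- ln (- t)))) has_vector_derivative
    f (qscale \<alpha> (exp (s / k)) (Y s))) (at t)"
proof (rule has_vector_derivative_vecI)
  fix i
  define \<sigma> where "\<sigma> = exp (s / k)"
  have \<sigma>: "\<sigma> > 0" by (simp add: \<sigma>_def)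
  define D where "D = F (Y s) $ i - real (\<alpha> i) / k * Y s $ i
    + \<sigma> powr (- (k + real (\<alpha> i))) * (f (qscale \<alpha> \<sigma> (Y s)) - F (qscale \<alpha> \<sigma> (Y s))) $ i"
  have diag: "(diag_type \<alpha> *v v) $ i = real (\<alpha> i) * v $ i" for v
    by (simp add: diag_type_def matrix_vector_mult_def if_distrib[of "\<lambda>x. x * _"] cong: if_cong)
  have "((\<lambda>s. Y s $ i) has_vector_derivative D) (at s)"
    using bounded_linear.has_vector_derivative[OF bounded_linear_vec_nth[of i] Y]
    by (simp add: D_def \<sigma>_def rescaled_def diag)
  then have Yi: "((\<lambda>s. Y s $ i) has_field_derivative D) (at (- ln (- t)))"
    by (simp add: has_real_derivative_iff_has_vector_derivative s)
  have ds: "((\<lambda>t. - ln (- t)) has_field_derivative exp s) (at t)"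
    using t by (auto intro!: derivative_eq_intros simp: s exp_minus field_simps)
  have E: "((\<lambda>t. exp (real (\<alpha> i) / k * (- ln (- t)))) has_field_derivative
      exp (real (\<alpha> i) / k * s) * (real (\<alpha> i) / k * exp s)) (at t)"
    using DERIV_chain2[OF DERIV_exp DERIV_cmult[OF ds, of "real (\<alpha> i) / k"]] by (simp add: s)
  have \<sigma>_eq: "exp (real (\<alpha> i) / k * u) = exp (u / k) ^ \<alpha> i" for u
    by (simp add: exp_of_nat_mult[symmetric])
  have "((\<lambda>t. exp (- ln (- t) / k) ^ \<alpha> i * Y (- ln (- t)) $ i) has_field_derivative
      exp s * \<sigma> ^ \<alpha> i * (real (\<alpha> i) / k * Y s $ i + D)) (at t)"
    using DERIV_mult[OF E DERIV_chain2[OF Yi ds]]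
    unfolding \<sigma>_eq s[symmetric] \<sigma>_def[symmetric]
    by (rule DERIV_cong) (simp add: algebra_simps)
  moreover have "exp s * \<sigma> ^ \<alpha> i * (real (\<alpha> i) / k * Y s $ i + D) = f (qscale \<alpha> \<sigma> (Y s)) $ i"
  proof -
    have e: "exp s * \<sigma> ^ \<alpha> i = \<sigma> powr (k + real (\<alpha> i))"
      using k by (simp add: powr_add powr_realpow[OF \<sigma>]) (simp add: powr_def \<sigma>_def)
    have "F (qscale \<alpha> \<sigma> (Y s)) $ i = \<sigma> powr (k + real (\<alpha> i)) * F (Y s) $ i"
      using qh \<sigma> unfolding quasi_homogeneous_def by blast
    moreover have "\<sigma> powr (k + real (\<alpha> i)) * \<sigma> powr (- (k + real (\<alpha> i))) = 1"
      using \<sigma> by (simp flip: powr_add)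
    ultimately show ?thesis
      unfolding e D_def by (simp add: distrib_left mult.assoc[symmetric])
  qed
  ultimately show "((\<lambda>t. qscale \<alpha> (exp (- ln (- t) / k)) (Y (- ln (- t))) $ i) has_vector_derivative
      f (qscale \<alpha> (exp (s / k)) (Y s)) $ i) (at t)"
    by (simp add: has_real_derivative_iff_has_vector_derivative[symmetric] qscale_def \<sigma>_def)
qed

theorem theorem3p21:
  fixes \<alpha> :: "'n::finite \<Rightarrow> nat" and k :: real and r :: nat
    and f F :: "real^'n \<Rightarrow> real^'n" and \<epsilon> :: real and Y0 :: "real^'n"
  assumes "\<And>i. \<alpha> i > 0"
    and "k > 0"
    and "r \<ge> 2" and "C_r_map r f"
    and "asymp_quasi_homogeneous \<alpha> k f F"
    and "C_r_map 1 F"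
    and "\<epsilon> > 0"
    and "\<And>i. (\<lambda>x. tilde_in \<alpha> k (\<lambda>y. f y - F y) x $ i)
               \<in> O[to_horizon \<alpha>](\<lambda>x. kappa \<alpha> x powr (- (1 + \<epsilon>)))"
    and "\<And>i l. (\<lambda>x. frechet_derivative (\<lambda>z. tilde_in \<alpha> k (\<lambda>y. f y - F y) z $ i) (at x) (axis l 1))
               \<in> o[to_horizon \<alpha>](\<lambda>x. kappa \<alpha> x powr (- (1 + \<epsilon>)))"
    and "Y0 \<noteq> 0"
    and "- ((1 / k) *\<^sub>R (diag_type \<alpha> *v Y0)) + F Y0 = 0"
    and "\<And>xs. xs = qscale \<alpha> (1 / pfun \<alpha> Y0) Y0 \<Longrightarrow> horizon_equilibrium \<alpha> k f F xs
               \<Longrightarrow> Gfun \<alpha> k f F xs > 0"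
    and "hyperbolic_matrix (blowup_matrix \<alpha> k F Y0)"
  shows "\<exists>(y :: real \<Rightarrow> real^'n) t0 tmax. t0 < tmax
           \<and> solves_on f y {t0..<tmax}
           \<and> filterlim (\<lambda>t. norm (y t)) at_top (at_left tmax)
           \<and> (\<forall>i. Y0 $ i \<noteq> 0 \<longrightarrow>
                (\<lambda>t. y t $ i) \<sim>[at_left tmax]
                (\<lambda>t. Y0 $ i * (tmax - t) powr (- (real (\<alpha> i) / k))))"
proof -
  note \<alpha> = assms(1) and k = assms(2)
  have qh: "quasi_homogeneous \<alpha> k F" using assms(5) by (simp add: asymp_quasi_homogeneous_def)
  have f: "f differentiable (at y)" for y
    using assms(3,4) by (cases r) auto
  have bal: "F Y0 = (1 / k) *\<^sub>R (diag_type \<alpha> *v Y0)" using assms(11) by (simp add: add_eq_0_iff)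
  obtain Y S where Y: "(Y \<longlongrightarrow> Y0) at_top"
    "\<And>s. s \<ge> S \<Longrightarrow> (Y has_vector_derivative
      F (Y s) - (1 / k) *\<^sub>R (diag_type \<alpha> *v Y s) + rescaled \<alpha> k (\<lambda>y. f y - F y) (exp (s / k)) (Y s)) (at s)"
    using rescaled_limit_solution[where \<alpha>=\<alpha> and k=k and f=f, OF \<alpha> k f assms(6)
        less_imp_le[OF assms(7)] assms(8,9,10) bal assms(13)] by blast
  define s where "s t = - ln (- t)" for t :: real
  define y where "y t = qscale \<alpha> (exp (s t / k)) (Y (s t))" for t
  \<comment> \<open>The time at which \<open>s t0 = S\<close>; the blow-up time is 0.\<close>
  define t0 where "t0 = - exp (- S)"
  have sol: "solves_on f y {t0..<0}"
    unfolding solves_on_def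
  proof
    fix t assume t: "t \<in> {t0..<0}"
    then have "ln (- t) \<le> ln (exp (- S))" by (subst ln_le_cancel_iff) (auto simp: t0_def)
    then have "s t \<ge> S" by (simp add: s_def)
    from solves_on_from_rescaled[OF k qh _ Y(2)[OF this] s_def] t
    have "(y has_vector_derivative f (y t)) (at t)"
      unfolding y_def[abs_def] s_def by simp
    then show "(y has_vector_derivative f (y t)) (at t within {t0..<0})"
      by (rule has_vector_derivative_at_within)
  qed
  have s_top: "filterlim s at_top (at_left 0)"
    unfolding filterlim_at_left_to_right s_def
    using ln_at_0 by (simp add: filterlim_uminus_at_top)
  have Ys: "((\<lambda>t. Y (s t) $ i) \<longlongrightarrow> Y0 $ i) (at_left 0)" for i
    by (rule tendsto_vec_nth[OF filterlim_compose[OF Y(1) s_top]])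
  have y_nth: "y t $ i = Y (s t) $ i * exp (s t / k) ^ \<alpha> i" for t i
    by (simp add: y_def qscale_def)
  have scale_top: "filterlim (\<lambda>t. exp (s t / k) ^ \<alpha> i) at_top (at_left 0)" for i
  proof -
    have "filterlim (\<lambda>t. (1 / k) * s t) at_top (at_left 0)"
      using k by (intro filterlim_tendsto_pos_mult_at_top[OF tendsto_const _ s_top]) auto
    from filterlim_pow_at_top[OF \<alpha> filterlim_compose[OF exp_at_top this]]
    show ?thesis by simp
  qed
  have norm_top: "filterlim (\<lambda>t. norm (y t)) at_top (at_left 0)"
  proof -
    \<comment> \<open>A single nonzero component of Y0 forces blow-up: there Y_i stays away from 0
      while its factor \<sigma>^(\<alpha> i) tends to infinity.\<close>
    obtain i where i: "Y0 $ i \<noteq> 0" using assms(10) by (auto simp: vec_eq_iff)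
    have "filterlim (\<lambda>t. \<bar>Y (s t) $ i\<bar> * exp (s t / k) ^ \<alpha> i) at_top (at_left 0)"
      by (rule filterlim_tendsto_pos_mult_at_top[OF tendsto_rabs[OF Ys] _ scale_top]) (use i in simp)
    then show ?thesis
      by (rule filterlim_at_top_mono)
        (use component_le_norm_cart[of "y _" i] in \<open>auto simp: y_nth abs_mult\<close>)
  qed
  have asymp: "(\<lambda>t. y t $ i) \<sim>[at_left 0] (\<lambda>t. Y0 $ i * (0 - t) powr (- (real (\<alpha> i) / k)))"
    if i: "Y0 $ i \<noteq> 0" for i
  proof -
    have "(\<lambda>t. y t $ i) \<sim>[at_left 0] (\<lambda>t. Y0 $ i * exp (s t / k) ^ \<alpha> i)"
      unfolding y_nth by (intro asymp_equiv_mult asymp_equiv_refl tendsto_imp_asymp_equiv_const Ys i)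
    \<comment> \<open>For negative t the scale exp(s/k) is exactly (-t)^(-1/k), so the two sides
      agree there.\<close>
    also have "\<forall>\<^sub>F t in at_left 0. Y0 $ i * exp (s t / k) ^ \<alpha> i = Y0 $ i * (0 - t) powr (- (real (\<alpha> i) / k))"
      by (auto simp: eventually_at_filter powr_def s_def exp_of_nat_mult[symmetric] field_simps)
    finally show ?thesis .
  qed
  have "t0 < 0" by (simp add: t0_def)
  with sol norm_top asymp show ?thesis by blast
qed

end
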